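(* Let $(X,d)$ be a complete metric space and let $f : X \to [0,\infty]$ be proper and lower semicontinuous. Suppose that $x_0\in\mathrm{dom}(f)$ and $r>0$ satisfy Condition $(A)$ for some parameter function $\theta$. For some $T\in(0,\infty]$, let $(y_t)_{t\in[0,T)}$ be a curve of maximal slope for $f$ starting at $x_0$. Then: (i) (confinement) $y_t\in\overline{B_r(x_0)}$ for all $0\le t<T$. Moreover, $y_t\in B_r(x_0)$ for all $0\le t<T$ with $f(y_t)>0$. (ii) (convergence) $y_T:=\lim_{t\to T}y_t$ exists and belongs to $\overline{B_r(x_0)}$. Moreover, $$\theta(f(y_s))-\theta(f(y_t))\ \ge\ d(y_t,y_s)\qquad\text{for all } 0\le s\le t\le T .$$ In particular, $y_T\in B_r(x_0)$ if $f(y_T)>0$. (iii) (convergence rates) Set $t_*:=\min\{\inf\{t\in[0,T): f(y_t)=0\},\,T\}$. For all $0\le t\le t_*$ the following bounds hold: $$\Gamma\big(d(y_t,y_T)\big)\le \Gamma(r)-t \quad (\text{whenever } r<\theta(\infty),\text{ so that }\Gamma(r)\text{ is defined}),$$ $$\eta(f(y_t))\le \eta(f(x_0))-t .$$ Moreover, if $T=\infty$ then $f(y_\infty)=0$.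
   Context: $B_r(x_0)$ is the open ball of radius $r$ around $x_0$ and $\overline{B_r(x_0)}$ is its closure. $\mathrm{dom}(f)=\{x: f(x)<\infty\}$, and $f$ is proper if $\mathrm{dom}(f)\ne\emptyset$. Convention: $\inf\emptyset=+\infty$. Slope: $|D^-f|(x):=\limsup_{y\to x}\frac{[f(y)-f(x)]_-}{d(y,x)}$ with $a_-=\max\{-a,0\}$; by convention $|D^-f|(x)=0$ if $x\in\mathrm{dom}(f)$ is isolated and $|D^-f|(x)=+\infty$ if $x\notin\mathrm{dom}(f)$. Absolutely continuous curves: for an interval $J\subset\mathbb{R}$, $(y_t)_{t\in J}$ belongs to $AC^1_{\rm loc}(J;X)$ if there is $m:J\to\mathbb{R}$, integrable on every compact subset of $J$, with $d(y_t,y_s)\le\int_s^t m(u)\,du$ for all $s<t$ in $J$. Then the metric speed $|\dot y_t|:=\lim_{s\to t}d(y_s,y_t)/|s-t|$ exists for a.e. $t\in J$. Curve of maximal slope: $(y_t)_{t\in J}$ is a curve of maximal slope for $f$ if (a) $(y_t)_{t\in J}\in AC^1_{\rm loc}(J;X)$; (b) $(f(y_t))_{t\in J}\in AC^1_{\rm loc}(J;\mathbb{R})$; (c) $-\frac{d}{dt}f(y_t)\ge\frac12|\dot y_t|^2+\frac12|D^-f|(y_t)^2$ for a.e. $t\in J$. It starts at $x$ if $\lim_{t\downarrow\inf J}y_t=x$ (so $y_0=x$ when $J=[0,T)$). Parameter function: $\theta\in C([0,\infty))\cap C^1((0,\infty))$ with $\theta(0)=0$ and $\theta'(u)>0$ for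 $u>0$. Write $\theta(\infty):=\lim_{u\to\infty}\theta(u)$. Define $\eta:[0,\infty)\to[-\infty,\infty)$ by $\eta(u):=\int_1^u(\theta'(s))^2\,ds$ (possibly $\eta(0)=-\infty$) and $\Gamma:[0,\theta(\infty))\to[-\infty,\infty)$ by $\Gamma:=\eta\circ\theta^{-1}$. Condition $(A)$ for $x_0\in\mathrm{dom}(f)$, $r>0$ with parameter function $\theta$: $\theta(f(x_0))\le r$, and $\theta'(f(x))\cdot|D^-f|(x)\ge1$ for all $x\in B_r(x_0)$ with $0<f(x)\le f(x_0)$. *)

theory Defs
  imports "HOL-Analysis.Analysis"
begin

text \<open>Functions \<open>f\<close> with values in $[0,\infty]$ have type \<open>'a \<Rightarrow> ereal\<close>, with \<open>0 \<le> f x\<close> assumed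
  wherever it is needed.\<close>

definition dom_of :: "('a \<Rightarrow> ereal) \<Rightarrow> 'a set" where
  "dom_of f = {x. f x < \<infinity>}"

definition proper_fun :: "('a \<Rightarrow> ereal) \<Rightarrow> bool" where
  "proper_fun f \<longleftrightarrow> dom_of f \<noteq> {}"

definition lower_semicont :: "('a::topological_space \<Rightarrow> ereal) \<Rightarrow> bool" where
  "lower_semicont f \<longleftrightarrow> (\<forall>x. f x \<le> Liminf (at x) f)"

definition neg_part :: "ereal \<Rightarrow> ereal" where
  "neg_part a = max (- a) 0"

text \<open>The isolated case is separate because \<open>Limsup\<close> along the trivial filter is \<open>-\<infinity>\<close>.\<close>

definition slope :: "('a::metric_space \<Rightarrow> ereal) \<Rightarrow> 'a \<Rightarrow> ereal" where
  "slope f x =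
     (if x \<notin> dom_of f then \<infinity>
      else if x isolated_in UNIV then 0
      else Limsup (at x) (\<lambda>y. neg_part (f y - f x) / ereal (dist y x)))"

text \<open>A curve on \<open>J\<close> is a function on all reals of which only the values on \<open>J\<close> are used.\<close>

definition AC1_loc :: "real set \<Rightarrow> (real \<Rightarrow> 'a::metric_space) \<Rightarrow> bool" where
  "AC1_loc J y \<longleftrightarrow>
     (\<exists>m :: real \<Rightarrow> real.
        (\<forall>K. compact K \<and> K \<subseteq> J \<longrightarrow> m absolutely_integrable_on K) \<and>
        (\<forall>s\<in>J. \<forall>t\<in>J. s < t \<longrightarrow> dist (y t) (y s) \<le> (LINT u:{s..t}|lebesgue. m u)))"

text \<open>For curves in \<open>AC1_loc J\<close> this limit exists at almost every point of the interval \<open>J\<close>;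
  elsewhere the value is unspecified.\<close>

definition metric_speed :: "real set \<Rightarrow> (real \<Rightarrow> 'a::metric_space) \<Rightarrow> real \<Rightarrow> real" where
  "metric_speed J y t = Lim (at t within J) (\<lambda>s. dist (y s) (y t) / \<bar>s - t\<bar>)"

text \<open>Condition (b) includes that \<open>f\<close> is finite along the curve. The derivative in (c) exists at
  almost every point of \<open>J\<close> by (b), and at interior points of \<open>J\<close> it depends only on the curve
  on \<open>J\<close>. Inequality (c) is stated in the extended reals since the slope may be infinite.\<close>

definition max_slope_curve ::
    "('a::metric_space \<Rightarrow> ereal) \<Rightarrow> real set \<Rightarrow> (real \<Rightarrow> 'a) \<Rightarrow> bool" where
  "max_slope_curve f J y \<longleftrightarrow>
     AC1_loc J y \<and>
     (\<forall>t\<in>J. \<bar>f (y t)\<bar> \<noteq> \<infinity>) \<and> AC1_loc J (\<lambda>t. real_of_ereal (f (y t))) \<and>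
     (AE t in lebesgue. t \<in> J \<longrightarrow>
        ereal (- deriv (\<lambda>s. real_of_ereal (f (y s))) t)
          \<ge> ereal (1/2 * (metric_speed J y t)\<^sup>2) + ereal (1/2) * (slope f (y t))\<^sup>2)"

text \<open>The infimum of \<open>J\<close> is taken in the extended reals, so that \<open>J\<close> may be unbounded below.\<close>

definition starts_at :: "real set \<Rightarrow> (real \<Rightarrow> 'a::metric_space) \<Rightarrow> 'a \<Rightarrow> bool" where
  "starts_at J y x \<longleftrightarrow>
     ((\<lambda>t. y (real_of_ereal t)) \<longlongrightarrow> x) (at_right (INF t\<in>J. ereal t))"

definition parameter_function :: "(real \<Rightarrow> real) \<Rightarrow> bool" where
  "parameter_function \<theta> \<longleftrightarrow>
     continuous_on {0..} \<theta> \<and>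
     (\<forall>u>0. \<theta> differentiable (at u)) \<and> continuous_on {0<..} (deriv \<theta>) \<and>
     \<theta> 0 = 0 \<and> (\<forall>u>0. deriv \<theta> u > 0)"

definition theta_infty :: "(real \<Rightarrow> real) \<Rightarrow> ereal" where
  "theta_infty \<theta> = Lim at_top (\<lambda>u. ereal (\<theta> u))"

text \<open>The oriented integral of $(\theta')^2$ from 1 to \<open>u\<close>; for \<open>u = 0\<close> it may be \<open>-\<infinity>\<close>.\<close>

definition eta :: "(real \<Rightarrow> real) \<Rightarrow> real \<Rightarrow> ereal" where
  "eta \<theta> u =
     (if 1 \<le> u then enn2ereal (\<integral>\<^sup>+ s\<in>{1<..u}. ennreal ((deriv \<theta> s)\<^sup>2) \<partial>lborel)
      else - enn2ereal (\<integral>\<^sup>+ s\<in>{u<..1}. ennreal ((deriv \<theta> s)\<^sup>2) \<partial>lborel))"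

text \<open>Only meaningful for \<open>0 \<le> v\<close> with \<open>ereal v < theta_infty \<theta>\<close>.\<close>

definition Gam :: "(real \<Rightarrow> real) \<Rightarrow> real \<Rightarrow> ereal" where
  "Gam \<theta> v = eta \<theta> (the_inv_into {0..} \<theta> v)"

definition condition_A ::
    "('a::metric_space \<Rightarrow> ereal) \<Rightarrow> (real \<Rightarrow> real) \<Rightarrow> 'a \<Rightarrow> real \<Rightarrow> bool" where
  "condition_A f \<theta> x0 r \<longleftrightarrow>
     \<theta> (real_of_ereal (f x0)) \<le> r \<and>
     (\<forall>x \<in> ball x0 r. 0 < f x \<and> f x \<le> f x0 \<longrightarrow>
        ereal (deriv \<theta> (real_of_ereal (f x))) * slope f x \<ge> 1)"

text \<open>The interval $[0,T)$ for $T \in (0,\infty]$.\<close>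

definition times_below :: "ereal \<Rightarrow> real set" where
  "times_below T = {t. 0 \<le> t \<and> ereal t < T}"

text \<open>The curve on $[0,T)$ extended to the closed time interval $[0,T]$ by the endpoint \<open>yT\<close>.\<close>

definition extend_curve :: "ereal \<Rightarrow> (real \<Rightarrow> 'a) \<Rightarrow> 'a \<Rightarrow> ereal \<Rightarrow> 'a" where
  "extend_curve T y yT t = (if t < T then y (real_of_ereal t) else yT)"

definition t_star :: "('a \<Rightarrow> ereal) \<Rightarrow> ereal \<Rightarrow> (real \<Rightarrow> 'a) \<Rightarrow> ereal" where
  "t_star f T y = min (INF t \<in> {t \<in> times_below T. f (y t) = 0}. ereal t) T"

end

theory Submission
  imports Defs
begin

text \<open>
  Write \<open>h(t) = f(y\<^sub>t)\<close>.  At almost every time the derivative \<open>D = h'(t)\<close> and the metric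
  speed \<open>v\<close> both exist, and with \<open>S = |D\<^sup>-f|(y\<^sub>t)\<close> the curve satisfies
  \<open>-D \<ge> v\<^sup>2/2 + S\<^sup>2/2\<close>.  On the other hand, \<open>f\<close> decreases along any curve at most at the rate
  slope times speed, \<open>-D \<le> S v\<close> (lemma \<open>energy_decrease_le_slope_speed\<close>).  Together these give
  \<open>(v - S)\<^sup>2 \<le> 0\<close>, so \<open>v = S\<close> and \<open>-D = S\<^sup>2\<close>.  As long as the curve is in the ball and \<open>h > 0\<close>,
  Condition (A) reads \<open>\<theta>'(h) S \<ge> 1\<close>, and hence
    \<open>-(\<theta> \<circ> h)' = \<theta>'(h) S\<^sup>2 \<ge> S = v\<close>  and  \<open>-(G \<circ> h)' = \<theta>'(h)\<^sup>2 S\<^sup>2 \<ge> 1\<close>,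
  where \<open>G\<close> is a primitive of \<open>\<theta>'\<^sup>2\<close> (lemma \<open>dissipation_pointwise\<close>).

  The first inequality integrates to \<open>d(y\<^sub>t, y\<^sub>s) \<le> \<theta>(h(s)) - \<theta>(h(t))\<close>.  Applied up to a first
  exit time from the ball it gives \<open>d(y\<^sub>t, x\<^sub>0) \<le> r - \<theta>(h(t)) < r\<close>, so that the curve cannot
  leave the ball while \<open>h > 0\<close>; when \<open>h\<close> reaches 0 the curve stops, because \<open>h\<close> is
  nonincreasing and \<open>h' = 0\<close> forces \<open>v = 0\<close>.  The same inequality makes \<open>y\<close> Cauchy at \<open>T\<close>, and
  lower semicontinuity gives \<open>f(y\<^sub>T) \<le> h(t)\<close> for all \<open>t\<close>, which carries the estimates over to the
  endpoint.  The second inequality integrates to \<open>\<eta>(h(t)) \<le> \<eta>(h(0)) - t\<close>.  If \<open>T = \<infinity>\<close> and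
  \<open>f(y\<^sub>T) > 0\<close>, this forces \<open>\<eta>(f(y\<^sub>T)) = -\<infinity>\<close>, which is impossible.  The bound for
  \<open>\<Gamma>\<close> follows from \<open>d(y\<^sub>t, y\<^sub>T) \<le> \<theta>(h(t))\<close> and \<open>\<theta>(h(0)) \<le> r\<close> by monotonicity.

  Two facts of real analysis underlie this.  First, a function that is absolutely continuous
  (controlled by the primitive of an integrable function) and whose right upper Dini derivative is
  nonpositive almost everywhere is nonincreasing (lemma \<open>decreasing_of_Dini_nonpos_AE\<close>); this is
  how the pointwise inequalities along the curve are integrated.  Secondly, the metric speed and the
  derivative of an absolutely continuous function exist almost everywhere (lemmas
  \<open>AE_has_speed\<close> and \<open>AC_density\<close>), which is needed because \<^const>\<open>metric_speed\<close>
  and \<^const>\<open>deriv\<close> are unspecified where the limits do not exist.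
\<close>

section \<open>Primitives of integrable functions\<close>

text \<open>The primitive of \<open>M\<close> vanishing at \<open>-\<infinity>\<close>.  Absolute continuity of a map \<open>F\<close> is expressed
  below by the bound \<open>dist (F t) (F s) \<le> cumul M t - cumul M s\<close> for \<open>s \<le> t\<close>, with \<open>M\<close>
  nonnegative and Lebesgue integrable on the whole line.\<close>
definition cumul :: "(real \<Rightarrow> real) \<Rightarrow> real \<Rightarrow> real" where
  "cumul M t = (LINT x:{..t}|lborel. M x)"

lemma set_integrable_of_integrable:
  fixes M :: "real \<Rightarrow> real"
  assumes "integrable lborel M" "S \<in> sets borel"
  shows "set_integrable lborel S M"
  using assms unfolding set_integrable_def real_scaleR_def
  by (subst mult.commute) (rule integrable_real_mult_indicator, auto)

lemma cumul_diff:
  assumes "integrable lborel M" "s \<le> t"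
  shows "cumul M t - cumul M s = (LINT x:{s<..t}|lborel. M x)"
proof -
  have "{..t} = {..s} \<union> {s<..t}" using assms(2) by auto
  then have "cumul M t = (LINT x:{..s}|lborel. M x) + (LINT x:{s<..t}|lborel. M x)"
    unfolding cumul_def
    by (simp, subst set_integral_Un) (auto intro!: set_integrable_of_integrable assms)
  then show ?thesis by (simp add: cumul_def)
qed

lemma cumul_diff_integral:
  assumes "integrable lborel M" "s \<le> t"
  shows "cumul M t - cumul M s = integral {s..t} M"
proof -
  have "cumul M t - cumul M s = integral {s<..t} M"
    using cumul_diff[OF assms] set_borel_integral_eq_integral(2)[OF set_integrable_of_integrable[OF assms(1)]]
    by simp
  also have "\<dots> = integral {s..t} M"
    by (rule integral_subset_negligible) (auto intro: negligible_subset[of "{s}"])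
  finally show ?thesis .
qed

lemma integrable_on_interval:
  fixes M :: "real \<Rightarrow> real"
  assumes "integrable lborel M" shows "M integrable_on {s..t}"
  using set_borel_integral_eq_integral(1)[OF set_integrable_of_integrable[OF assms]] by simp

lemma cumul_mono:
  assumes "integrable lborel M" "\<And>x. 0 \<le> M x" "s \<le> t"
  shows "cumul M s \<le> cumul M t"
  using cumul_diff_integral[OF assms(1,3)] integral_nonneg[OF integrable_on_interval[OF assms(1)], of s t] assms(2)
  by (smt (verit))

lemma cumul_diff_mono:
  assumes "integrable lborel M" "integrable lborel N" "\<And>x. M x \<le> N x" "s \<le> t"
  shows "cumul M t - cumul M s \<le> cumul N t - cumul N s"
  unfolding cumul_diff_integral[OF assms(1,4)] cumul_diff_integral[OF assms(2,4)]
  by (rule integral_le) (auto intro: integrable_on_interval assms)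

lemma cumul_add:
  assumes "integrable lborel M" "integrable lborel N"
  shows "cumul (\<lambda>x. M x + N x) t = cumul M t + cumul N t"
  unfolding cumul_def by (rule set_integral_add) (auto intro: set_integrable_of_integrable assms)

lemma cumul_cmult: "cumul (\<lambda>x. c * M x) t = c * cumul M t"
  unfolding cumul_def by simp

lemma continuous_cumul:
  assumes "integrable lborel M" shows "continuous_on S (cumul M)"
proof -
  have "isCont (cumul M) t" for t
  proof -
    have "continuous_on {t-1..t+1} (\<lambda>x. cumul M (t-1) + integral {t-1..x} M)"
      by (intro continuous_intros indefinite_integral_continuous_1 integrable_on_interval assms)
    then have "continuous_on {t-1..t+1} (cumul M)"
      by (rule continuous_on_eq) (use cumul_diff_integral[OF assms, of "t-1"] in force)
    then show ?thesis
      by (rule continuous_on_interior) simp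
  qed
  then show ?thesis by (simp add: continuous_at_imp_continuous_on)
qed

lemma AE_lborel_iff_negligible:
  "(AE x in lborel. P x) \<longleftrightarrow> negligible {x::real. \<not> P x}"
proof -
  have "(AE x in lborel. P x) \<longleftrightarrow> (AE x in lebesgue. P x)" by (simp add: AE_completion_iff)
  also have "\<dots> \<longleftrightarrow> {x. \<not> P x} \<in> null_sets lebesgue"
    using completion.AE_iff_null_sets[of P lborel] by simp
  finally show ?thesis by (simp add: negligible_iff_null_sets)
qed

text \<open>Lebesgue differentiation.  The right derivative is \<open>integrable_ccontinuous_explicit\<close>; the left
  derivative at \<open>t\<close> is the right derivative at \<open>-t\<close> for the reflected integrand.\<close>
lemma cumul_has_real_derivative:
  assumes M: "integrable lborel M"
  shows "AE t in lborel. (cumul M has_real_derivative M t) (at t)"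
proof -
  obtain N1 where N1: "negligible N1" "\<And>x e. \<lbrakk>x \<notin> N1; 0 < e\<rbrakk> \<Longrightarrow>
       \<exists>d>0. \<forall>h. 0 < h \<and> h < d \<longrightarrow> norm (integral (cbox x (x + h *\<^sub>R One)) M /\<^sub>R h ^ DIM(real) - M x) < e"
    using integrable_ccontinuous_explicit[of M] integrable_on_interval[OF M] by (metis cbox_interval)
  have M': "integrable lborel (\<lambda>x. M (- x))"
    using lborel_integrable_real_affine[OF M, of "-1" 0] by simp
  obtain N2 where N2: "negligible N2" "\<And>x e. \<lbrakk>x \<notin> N2; 0 < e\<rbrakk> \<Longrightarrow>
       \<exists>d>0. \<forall>h. 0 < h \<and> h < d \<longrightarrow> norm (integral (cbox x (x + h *\<^sub>R One)) (\<lambda>x. M (- x)) /\<^sub>R h ^ DIM(real) - M (- x)) < e"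
    using integrable_ccontinuous_explicit[of "\<lambda>x. M (- x)"] integrable_on_interval[OF M'] by (metis cbox_interval)
  have neg: "negligible (N1 \<union> uminus ` N2)"
    using N1(1) N2(1)
    by (auto intro!: negligible_Un negligible_differentiable_image_negligible derivative_intros)
  have "(cumul M has_real_derivative M t) (at t)" if t: "t \<notin> N1 \<union> uminus ` N2" for t
    unfolding has_field_derivative_iff
  proof (rule LIM_I)
    fix e :: real assume "e > 0"
    from N1(2)[of t e] t \<open>e>0\<close> obtain d1 where d1: "d1 > 0"
      "\<And>h. 0 < h \<Longrightarrow> h < d1 \<Longrightarrow> \<bar>integral {t..t+h} M / h - M t\<bar> < e"
      by (auto simp: divide_inverse mult.commute)
    have "- t \<notin> N2" using t by force
    from N2(2)[OF this \<open>e>0\<close>] obtain d2 where d2: "d2 > 0"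
      "\<And>h. 0 < h \<Longrightarrow> h < d2 \<Longrightarrow> \<bar>integral {-t..-t+h} (\<lambda>x. M (-x)) / h - M t\<bar> < e"
      by (auto simp: divide_inverse mult.commute)
    show "\<exists>s>0. \<forall>x. x \<noteq> t \<and> norm (x - t) < s \<longrightarrow> norm ((cumul M x - cumul M t) / (x - t) - M t) < e"
    proof (intro exI[of _ "min d1 d2"] conjI allI impI)
      fix x assume x: "x \<noteq> t \<and> norm (x - t) < min d1 d2"
      show "norm ((cumul M x - cumul M t) / (x - t) - M t) < e"
      proof (cases "t < x")
        case True
        with d1(2)[of "x - t"] x cumul_diff_integral[OF M, of t x] show ?thesis by simp
      next
        case False
        then have "x < t" using x by simp
        then have "cumul M t - cumul M x = integral {-t..-t+(t-x)} (\<lambda>x. M (-x))"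
          using cumul_diff_integral[OF M, of x t] integral_reflect_real[of t x M] by simp
        moreover have "(cumul M x - cumul M t) / (x - t) = (cumul M t - cumul M x) / (t - x)"
          by (metis minus_diff_eq minus_divide_divide)
        ultimately show ?thesis
          using d2(2)[of "t - x"] x \<open>x < t\<close> by simp
      qed
    qed (use d1 d2 in auto)
  qed
  then have "{t. \<not> (cumul M has_real_derivative M t) (at t)} \<subseteq> N1 \<union> uminus ` N2" by blast
  then show ?thesis
    unfolding AE_lborel_iff_negligible using neg negligible_subset by blast
qed

lemma continuous_on_of_cumul_bound:
  fixes F :: "real \<Rightarrow> 'a::metric_space"
  assumes M: "integrable lborel M"
    and F: "\<And>s t. s \<in> S \<Longrightarrow> t \<in> S \<Longrightarrow> s \<le> t \<Longrightarrow> dist (F t) (F s) \<le> cumul M t - cumul M s"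
  shows "continuous_on S F"
proof (unfold continuous_on_def, intro ballI)
  fix t assume t: "t \<in> S"
  have bound: "dist (F s) (F t) \<le> \<bar>cumul M s - cumul M t\<bar>" if "s \<in> S" for s
    using F[of s t] F[of t s] t that by (cases "s \<le> t") (auto simp: dist_commute)
  have "((\<lambda>s. \<bar>cumul M s - cumul M t\<bar>) \<longlongrightarrow> \<bar>cumul M t - cumul M t\<bar>) (at t within S)"
    using continuous_cumul[OF M, of S] t unfolding continuous_on_def
    by (intro tendsto_intros) auto
  then have lim: "((\<lambda>s. \<bar>cumul M s - cumul M t\<bar>) \<longlongrightarrow> 0) (at t within S)" by simp
  have "eventually (\<lambda>s. norm (dist (F s) (F t)) \<le> \<bar>cumul M s - cumul M t\<bar>) (at t within S)"
    unfolding eventually_at_filter by (rule always_eventually) (use bound in simp)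
  then have "((\<lambda>s. dist (F s) (F t)) \<longlongrightarrow> 0) (at t within S)"
    by (rule Lim_null_comparison[OF _ lim])
  then show "(F \<longlongrightarrow> F t) (at t within S)" by (simp add: tendsto_dist_iff[symmetric])
qed

lemma emeasure_density_eq_LINT:
  fixes M :: "real \<Rightarrow> real"
  assumes M: "integrable lborel M" "\<And>x. 0 \<le> M x" and "X \<in> sets borel"
  shows "emeasure (density lborel (\<lambda>x. ennreal (M x))) X = ennreal (LINT x:X|lborel. M x)"
proof -
  have mes: "M \<in> borel_measurable borel" using M(1) by auto
  have "emeasure (density lborel (\<lambda>x. ennreal (M x))) X = (\<integral>\<^sup>+ x. ennreal (indicator X x *\<^sub>R M x) \<partial>lborel)"
    using assms mes
    by (subst emeasure_density) (auto intro!: nn_integral_cong split: split_indicator)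
  also have "\<dots> = ennreal (LINT x:X|lborel. M x)"
    unfolding set_lebesgue_integral_def
    by (rule nn_integral_eq_integral)
      (use set_integrable_of_integrable[OF M(1) assms(3)] M(2) in \<open>auto simp: set_integrable_def indicator_def\<close>)
  finally show ?thesis .
qed

section \<open>Monotonicity from the Dini derivative\<close>

lemma decreasing_of_locally_decreasing:
  fixes G :: "real \<Rightarrow> real"
  assumes "a \<le> b" "continuous_on {a..b} G"
    and loc: "\<And>t. a \<le> t \<Longrightarrow> t < b \<Longrightarrow> eventually (\<lambda>s. G s \<le> G t) (at_right t)"
  shows "G b \<le> G a"
proof -
  define S where "S = {a..b} \<inter> G -` {..G a}"
  have "closed S" unfolding S_def by (rule continuous_closed_preimage) (use assms in auto)
  moreover have "a \<in> S" using assms by (auto simp: S_def)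
  moreover have bdd: "bdd_above S" by (auto simp: S_def bdd_above_def)
  ultimately have c: "Sup S \<in> S" by (intro closed_contains_Sup) auto
  have "Sup S = b"
  proof (rule ccontr)
    assume "Sup S \<noteq> b"
    then have lt: "a \<le> Sup S" "Sup S < b" using c by (auto simp: S_def)
    have "eventually (\<lambda>s. G s \<le> G (Sup S) \<and> s < b \<and> Sup S < s) (at_right (Sup S))"
      using loc[OF lt] eventually_at_right_less lt(2)
      by (intro eventually_conj) (auto simp: eventually_at_right[OF lt(2)])
    then obtain s where s: "G s \<le> G (Sup S)" "s < b" "Sup S < s"
      using eventually_happens trivial_limit_at_right_real by blast
    then have "s \<in> S" using c lt by (auto simp: S_def)
    then show False using cSup_upper[OF _ bdd] s by fastforce
  qed
  then show ?thesis using c by (auto simp: S_def)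
qed

text \<open>The exceptional null set \<open>N\<close> is covered by an open \<open>U\<close> with \<open>\<integral>\<^sub>U M < e\<close>.  After subtracting
  from \<open>F\<close> the primitive of \<open>M\<close> restricted to \<open>U\<close>, and a line of slope \<open>e\<close>, the result is
  locally decreasing to the right at every point: off \<open>N\<close> by the Dini condition, on \<open>N\<close>
  because there \<open>F\<close> grows no faster than the subtracted primitive.\<close>
lemma decreasing_of_Dini_nonpos_AE:
  fixes F :: "real \<Rightarrow> real"
  assumes ab: "a \<le> b" and M: "integrable lborel M" "\<And>x. 0 \<le> M x"
    and F: "\<And>s t. a \<le> s \<Longrightarrow> s \<le> t \<Longrightarrow> t \<le> b \<Longrightarrow> \<bar>F t - F s\<bar> \<le> cumul M t - cumul M s"
    and Dini: "AE t in lborel. a < t \<and> t < b \<longrightarrow>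
        (\<forall>\<epsilon>>0. eventually (\<lambda>s. F s - F t \<le> \<epsilon> * (s - t)) (at_right t))"
  shows "F b \<le> F a"
proof -
  \<comment> \<open>The left endpoint is a null set, so it may be excluded from the good times.\<close>
  have "AE t in lborel. t \<noteq> a \<longrightarrow> t < b \<longrightarrow> a \<le> t \<longrightarrow>
        (\<forall>\<epsilon>>0. eventually (\<lambda>s. F s - F t \<le> \<epsilon> * (s - t)) (at_right t))"
    using Dini by eventually_elim auto
  moreover have "AE t in lborel. t \<noteq> a" by (rule AE_lborel_singleton)
  ultimately have "AE t in lborel. t < b \<longrightarrow> a \<le> t \<longrightarrow>
        (\<forall>\<epsilon>>0. eventually (\<lambda>s. F s - F t \<le> \<epsilon> * (s - t)) (at_right t))"
    by eventually_elim auto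
  then obtain N where N: "N \<in> null_sets lborel" "\<And>t \<epsilon>. t \<notin> N \<Longrightarrow> t < b \<Longrightarrow> a \<le> t \<Longrightarrow> \<epsilon> > 0 \<Longrightarrow>
        eventually (\<lambda>s. F s - F t \<le> \<epsilon> * (s - t)) (at_right t)"
    by (auto elim!: AE_E3)
  have contF: "continuous_on {a..b} F"
    by (rule continuous_on_of_cumul_bound[OF M(1)]) (use F in \<open>auto simp: dist_real_def\<close>)
  define mu where "mu = density lborel (\<lambda>x. ennreal (M x))"
  have mes[measurable]: "M \<in> borel_measurable borel" using M(1) by auto
  have sm: "sets mu = sets borel" by (simp add: mu_def)
  have muX: "emeasure mu X = ennreal (LINT x:X|lborel. M x)" if "X \<in> sets borel" for X
    unfolding mu_def by (rule emeasure_density_eq_LINT[OF M that])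
  have "emeasure mu N = 0"
    unfolding mu_def using N(1) absolutely_continuousI_density[of "\<lambda>x. ennreal (M x)" lborel]
    by (auto simp: absolutely_continuous_def)
  have fin: "emeasure mu (space mu) \<noteq> \<infinity>"
    using muX[of UNIV] by (simp add: mu_def)
  have main: "F b - F a \<le> e * (b - a) + e" if "e > 0" for e
  proof -
    have "N \<in> sets borel" using N(1) by auto
    from outer_regular[OF sm fin this] \<open>emeasure mu N = 0\<close>
    have "(INF U\<in>{U. N \<subseteq> U \<and> open U}. emeasure mu U) < ennreal e" using that by simp
    then obtain U where U: "N \<subseteq> U" "open U" "emeasure mu U < ennreal e"
      unfolding INF_less_iff by auto
    have US: "U \<in> sets borel" using U(2) by simp
    define MU where "MU = (\<lambda>x. indicator U x * M x)"
    have iMU: "integrable lborel MU"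
      using set_integrable_of_integrable[OF M(1) US] unfolding set_integrable_def MU_def by simp
    have MU0: "0 \<le> MU x" "MU x \<le> M x" for x using M(2) by (auto simp: MU_def indicator_def)
    define G where "G = (\<lambda>t. F t - cumul MU t - e * (t - a))"
    have "G b \<le> G a"
    proof (rule decreasing_of_locally_decreasing[OF ab])
      show "continuous_on {a..b} G"
        unfolding G_def by (intro continuous_intros contF continuous_cumul iMU)
    next
      fix t assume t: "a \<le> t" "t < b"
      have B: "cumul MU t \<le> cumul MU s" if "t \<le> s" for s
        by (rule cumul_mono) (use iMU MU0 that in auto)
      show "eventually (\<lambda>s. G s \<le> G t) (at_right t)"
      proof (cases "t \<in> N")
        case False
        have "eventually (\<lambda>s. s > t) (at_right t)" by (rule eventually_at_right_less)
        with N(2)[OF False t(2,1) \<open>e > 0\<close>] show ?thesis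
        proof eventually_elim
          case (elim s)
          with B[of s] show ?case by (simp add: G_def algebra_simps)
        qed
      next
        case True
        then have "t \<in> U" using U by auto
        then obtain d where d: "d > 0" "ball t d \<subseteq> U" using U(2) openE by blast
        have "eventually (\<lambda>s. s > t \<and> s < min b (t + d)) (at_right t)"
          using t d by (auto simp: eventually_at_right_field intro!: exI[of _ "min b (t + d)"])
        then show ?thesis
        proof eventually_elim
          case (elim s)
          have "cumul M s - cumul M t = cumul MU s - cumul MU t"
          proof -
            have "u \<in> U" if "u \<in> {t..s}" for u
              using that d elim by (auto simp: dist_real_def subset_iff)
            then have "integral {t..s} M = integral {t..s} MU"
              by (intro integral_cong) (auto simp: MU_def)
            then show ?thesis using cumul_diff_integral[OF M(1)] cumul_diff_integral[OF iMU] elim by simp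
          qed
          moreover have "0 \<le> e * (s - t)" using elim that by simp
          ultimately show ?case using F[of t s] elim t by (simp add: G_def algebra_simps)
        qed
      qed
    qed
    then have "F b - F a \<le> (cumul MU b - cumul MU a) + e * (b - a)" by (simp add: G_def)
    also have "cumul MU b - cumul MU a \<le> e"
    proof -
      have "cumul MU b - cumul MU a = (LINT x:{a<..b}|lborel. MU x)" by (rule cumul_diff[OF iMU ab])
      also have "\<dots> \<le> (LINT x|lborel. MU x)"
        unfolding set_lebesgue_integral_def
        by (rule integral_mono) (use iMU set_integrable_of_integrable[OF iMU, of "{a<..b}"] MU0 in
           \<open>auto simp: set_integrable_def indicator_def\<close>)
      also have "\<dots> = (LINT x:U|lborel. M x)" by (simp add: set_lebesgue_integral_def MU_def)
      also have "\<dots> \<le> e"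
      proof -
        have "ennreal (LINT x:U|lborel. M x) < ennreal e" using U(3) muX[OF US] by simp
        then show ?thesis using ennreal_leI[of e "LINT x:U|lborel. M x"] by (meson leD le_cases)
      qed
      finally show ?thesis .
    qed
    finally show ?thesis by simp
  qed
  show ?thesis
  proof (rule field_le_epsilon)
    fix e :: real assume "e > 0"
    define d where "d = e / (b - a + 1)"
    have "d > 0" "d * (b - a + 1) = e" using ab \<open>e > 0\<close> by (auto simp: d_def)
    then show "F b \<le> F a + e" using main[of d] by (simp add: algebra_simps)
  qed
qed

section \<open>Absolutely continuous functions as integrals\<close>

lemma UN_Ioc_eq_UNIV: "(\<Union>n::nat. {- real n<..real n}) = UNIV"
proof -
  have "\<exists>n. x \<in> {- real n<..real n}" for x :: real
  proof -
    obtain n where "\<bar>x\<bar> < real n" using reals_Archimedean2 by blast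
    then have "x \<in> {- real n<..real n}" by auto
    then show ?thesis ..
  qed
  then show ?thesis by blast
qed

lemma finite_interval_measure_of_bound:
  fixes P :: "real \<Rightarrow> real"
  assumes mono: "\<And>s t. s \<le> t \<Longrightarrow> P s \<le> P t" and cont: "continuous_on UNIV P"
    and K: "\<And>s t. s \<le> t \<Longrightarrow> P t - P s \<le> K"
  shows "finite_measure (interval_measure P)"
proof
  have cr: "continuous (at_right a) P" for a
    using cont by (simp add: continuous_on_eq_continuous_at continuous_at_imp_continuous_within)
  have Un: "(\<Union>n::nat. {- real n<..real n}) = UNIV" by (rule UN_Ioc_eq_UNIV)
  have "(\<lambda>n. emeasure (interval_measure P) {- real n<..real n}) \<longlonglongrightarrow>
      emeasure (interval_measure P) (\<Union>n::nat. {- real n<..real n})"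
    by (intro Lim_emeasure_incseq) (auto simp: incseq_def)
  moreover have "emeasure (interval_measure P) {- real n<..real n} \<le> ennreal K" for n
    using mono cr K[of "- real n" "real n"] by (subst emeasure_interval_measure_Ioc) (auto intro: ennreal_leI)
  ultimately have "emeasure (interval_measure P) UNIV \<le> ennreal K"
    unfolding Un by (intro LIMSEQ_le_const2) auto
  then show "emeasure (interval_measure P) (space (interval_measure P)) \<noteq> \<infinity>"
    using ennreal_less_top[of K] by (auto simp: top_unique)
qed

text \<open>The Radon-Nikodym theorem for the Stieltjes measure \<open>nu\<close> of \<open>P\<close>.  Its absolute continuity holds
  because \<open>nu \<le> M dx\<close>: the Stieltjes measure \<open>nu'\<close> of the nondecreasing function
  \<open>cumul M - P\<close> is the difference.\<close>
lemma mono_AC_density: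
  fixes P :: "real \<Rightarrow> real"
  assumes M: "integrable lborel M" "\<And>x. 0 \<le> M x"
    and P: "\<And>s t. s \<le> t \<Longrightarrow> P s \<le> P t" "\<And>s t. s \<le> t \<Longrightarrow> P t - P s \<le> cumul M t - cumul M s"
  obtains p where "integrable lborel p" "\<And>s t. s \<le> t \<Longrightarrow> P t - P s = cumul p t - cumul p s"
proof -
  define Q where "Q = (\<lambda>t. cumul M t - P t)"
  have Q: "Q s \<le> Q t" if "s \<le> t" for s t using P(2)[OF that] by (simp add: Q_def)
  have cont: "continuous_on UNIV P"
    by (rule continuous_on_of_cumul_bound[OF M(1)]) (use P in \<open>simp add: dist_real_def\<close>)
  have contQ: "continuous_on UNIV Q"
    unfolding Q_def by (intro continuous_intros cont continuous_cumul M)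
  define K where "K = (LINT x|lborel. M x)"
  have K: "cumul M t - cumul M s \<le> K" if "s \<le> t" for s t
  proof -
    have "cumul M t - cumul M s = (LINT x:{s<..t}|lborel. M x)" by (rule cumul_diff[OF M(1) that])
    also have "\<dots> \<le> K" unfolding set_lebesgue_integral_def K_def
      by (rule integral_mono) (use M set_integrable_of_integrable[OF M(1), of "{s<..t}"] in
           \<open>auto simp: set_integrable_def indicator_def\<close>)
    finally show ?thesis .
  qed
  define nu where "nu = interval_measure P"
  define nu' where "nu' = interval_measure Q"
  define mu where "mu = density lborel (\<lambda>x. ennreal (M x))"
  have [simp]: "sets nu = sets borel" "sets nu' = sets borel" "sets mu = sets borel"
      "space nu = UNIV" "space nu' = UNIV" "space mu = UNIV"
    by (auto simp: nu_def nu'_def mu_def)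
  interpret nu: finite_measure nu unfolding nu_def
    by (rule finite_interval_measure_of_bound[OF P(1) cont, of K]) (blast intro: order_trans P(2) K)+
  have QK: "Q t - Q s \<le> K" if "s \<le> t" for s t
    using P(1)[OF that] K[OF that] by (simp add: Q_def)
  interpret nu': finite_measure nu' unfolding nu'_def
    by (rule finite_interval_measure_of_bound[OF Q contQ QK])
  interpret mu: finite_measure mu
    by standard (use emeasure_density_eq_LINT[OF M, of UNIV] in \<open>simp add: mu_def\<close>)
  have cr: "continuous (at_right a) P" "continuous (at_right a) Q" for a
    using cont contQ by (auto simp: continuous_on_eq_continuous_at continuous_at_imp_continuous_within)
  have Ioc: "measure nu {a<..b} + measure nu' {a<..b} = measure mu {a<..b}" for a b
  proof (cases "a \<le> b")
    case True
    have "emeasure mu {a<..b} = ennreal (cumul M b - cumul M a)"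
      unfolding mu_def cumul_diff[OF M(1) True] by (rule emeasure_density_eq_LINT[OF M]) auto
    then have "measure mu {a<..b} = cumul M b - cumul M a"
      using cumul_mono[OF M True] by (simp add: measure_def)
    moreover have "measure nu {a<..b} = P b - P a"
      unfolding nu_def using P(1) cr True by (intro measure_interval_measure_Ioc) auto
    moreover have "measure nu' {a<..b} = Q b - Q a"
      unfolding nu'_def using Q cr True by (intro measure_interval_measure_Ioc) auto
    ultimately show ?thesis by (simp add: Q_def)
  qed simp
  have Un: "(\<Union>n::nat. {- real n<..real n}) = UNIV"
    by (rule UN_Ioc_eq_UNIV)
  have total: "measure nu UNIV + measure nu' UNIV = measure mu UNIV"
  proof -
    have inc: "incseq (\<lambda>n. {- real n<..real n})" by (auto simp: incseq_def)
    have "range (\<lambda>n. {- real n<..real n}) \<subseteq> sets borel" by auto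
    note this[simp]
    have "(\<lambda>n. measure nu {- real n<..real n} + measure nu' {- real n<..real n})
        \<longlonglongrightarrow> measure nu UNIV + measure nu' UNIV"
      using nu.finite_Lim_measure_incseq[OF _ inc] nu'.finite_Lim_measure_incseq[OF _ inc]
      unfolding Un by (intro tendsto_add) auto
    moreover have "(\<lambda>n. measure mu {- real n<..real n}) \<longlonglongrightarrow> measure mu UNIV"
      using mu.finite_Lim_measure_incseq[OF _ inc] unfolding Un by auto
    ultimately show ?thesis unfolding Ioc by (rule LIMSEQ_unique)
  qed
  \<comment> \<open>The identity extends from half-open intervals to Borel sets by Dynkin induction.\<close>
  have le: "measure nu X \<le> measure mu X" if "X \<in> sets borel" for X
  proof -
    have gen: "sets borel = sigma_sets UNIV (range (\<lambda>(a, b). {a<..b::real}))"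
      by (subst borel_sigma_sets_Ioc) (rule sets_measure_of, auto)
    have "Int_stable (range (\<lambda>(a, b). {a<..b::real}))" 
    proof (rule Int_stableI)
      fix A B :: "real set" assume "A \<in> range (\<lambda>(a, b). {a<..b})" "B \<in> range (\<lambda>(a, b). {a<..b})"
      then obtain a b c d where "A = {a<..b}" "B = {c<..d}" by auto
      then have "A \<inter> B = (\<lambda>(a, b). {a<..b}) (max a c, min b d)" by auto
      then show "A \<inter> B \<in> range (\<lambda>(a, b). {a<..b})" by blast
    qed
    moreover have "range (\<lambda>(a, b). {a<..b}) \<subseteq> Pow (UNIV :: real set)" by simp
    ultimately have "measure nu X + measure nu' X = measure mu X"
      using that[unfolded gen]
    proof (induction rule: sigma_sets_induct_disjoint)
      case (basic A)
      then show ?case using Ioc by auto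
    next
      case empty then show ?case by simp
    next
      case (compl A)
      then have "A \<in> sets borel" by (simp add: gen)
      then show ?case using compl total
        using nu.finite_measure_compl[of A] nu'.finite_measure_compl[of A] mu.finite_measure_compl[of A]
        by simp
    next
      case (union A)
      then have A: "range A \<subseteq> sets borel" by (simp add: gen)
      have "(\<lambda>i. measure nu (A i) + measure nu' (A i)) sums
          (measure nu (\<Union>i. A i) + measure nu' (\<Union>i. A i))"
        using A union(1) by (intro sums_add nu.finite_measure_UNION nu'.finite_measure_UNION) auto
      moreover have "(\<lambda>i. measure mu (A i)) sums measure mu (\<Union>i. A i)"
        using A union(1) by (intro mu.finite_measure_UNION) auto
      ultimately show ?case using union(3) sums_unique2 by simp
    qed
    then show ?thesis by (smt (verit) measure_nonneg)
  qed
  have mes: "M \<in> borel_measurable borel" using M(1) by auto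
  have ac: "absolutely_continuous lborel nu"
    unfolding absolutely_continuous_def
  proof
    fix N assume N: "N \<in> null_sets (lborel :: real measure)"
    then have "N \<in> null_sets mu"
      using absolutely_continuousI_density[of "\<lambda>x. ennreal (M x)" lborel] mes
      by (auto simp: absolutely_continuous_def mu_def)
    then have "measure nu N \<le> 0" using le[of N] N by (simp add: measure_def null_sets_def)
    then show "N \<in> null_sets nu"
      using N by (auto simp: null_sets_def nu.emeasure_eq_measure measure_le_0_iff)
  qed
  define p' where "p' = RN_deriv lborel nu"
  have p'[measurable]: "p' \<in> borel_measurable borel" unfolding p'_def by measurable
  have dens: "density lborel p' = nu"
    unfolding p'_def by (rule sigma_finite_measure.density_RN_deriv[OF sigma_finite_lborel ac]) simp
  have nuX: "emeasure nu X = (\<integral>\<^sup>+x. p' x * indicator X x \<partial>lborel)" if "X \<in> sets borel" for X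
    unfolding dens[symmetric] by (rule emeasure_density) (use that in auto)
  have fin: "AE x in lborel. p' x \<noteq> \<infinity>"
    by (rule nn_integral_noteq_infinite) (use nuX[of UNIV] in \<open>auto simp: less_top[symmetric]\<close>)
  define p where "p = (\<lambda>x. enn2real (p' x))"
  have ep: "AE x in lborel. ennreal (p x) = p' x"
    using fin by eventually_elim (simp add: p_def less_top)
  have ip: "integrable lborel p"
  proof (rule integrableI_nonneg)
    show "p \<in> borel_measurable lborel" unfolding p_def by measurable
    have "(\<integral>\<^sup>+x. ennreal (p x) \<partial>lborel) = (\<integral>\<^sup>+x. p' x \<partial>lborel)"
      by (rule nn_integral_cong_AE[OF ep])
    also have "\<dots> = emeasure nu UNIV" using nuX[of UNIV] by simp
    finally show "(\<integral>\<^sup>+x. ennreal (p x) \<partial>lborel) < \<infinity>" by (simp add: less_top[symmetric])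
  qed (simp add: p_def)
  have p0: "0 \<le> p x" for x by (simp add: p_def)
  have "P t - P s = cumul p t - cumul p s" if "s \<le> t" for s t
  proof -
    have "ennreal (cumul p t - cumul p s) = emeasure (density lborel (\<lambda>x. ennreal (p x))) {s<..t}"
      unfolding cumul_diff[OF ip that] by (rule emeasure_density_eq_LINT[symmetric, OF ip p0]) auto
    also have "density lborel (\<lambda>x. ennreal (p x)) = density lborel p'"
      by (rule density_cong[OF _ _ ep]) (auto simp: p_def)
    also have "emeasure (density lborel p') {s<..t} = ennreal (P t - P s)"
      unfolding dens nu_def by (rule emeasure_interval_measure_Ioc[OF that]) (use P cr in auto)
    finally show ?thesis
      using P(1)[OF that] cumul_mono[OF ip p0 that] by simp
  qed
  then show ?thesis using ip that by blast
qed

text \<open>The fundamental theorem of calculus for a real absolutely continuous function: it is the primitive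
  of an integrable \<open>p\<close>, and \<open>p\<close> is its derivative almost everywhere.  The pointwise bound
  \<open>\<bar>p\<bar> \<le> M\<close> is arranged by truncating \<open>p\<close> on a null set.\<close>
lemma AC_density:
  fixes F :: "real \<Rightarrow> real"
  assumes M: "integrable lborel M" "\<And>x. 0 \<le> M x"
    and F: "\<And>s t. s \<le> t \<Longrightarrow> \<bar>F t - F s\<bar> \<le> cumul M t - cumul M s"
  obtains p where "integrable lborel p"
    "\<And>s t. s \<le> t \<Longrightarrow> F t - F s = cumul p t - cumul p s"
    "AE t in lborel. (F has_real_derivative p t) (at t)" "\<And>x. \<bar>p x\<bar> \<le> M x"
proof -
  define P where "P = (\<lambda>t. cumul M t + F t)"
  have iM2: "integrable lborel (\<lambda>x. 2 * M x)" using M by simp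
  have "0 \<le> 2 * M x" for x using M by simp
  moreover have "P s \<le> P t" if "s \<le> t" for s t using F[OF that] by (simp add: P_def)
  moreover have "P t - P s \<le> cumul (\<lambda>x. 2 * M x) t - cumul (\<lambda>x. 2 * M x) s" if "s \<le> t" for s t
    using F[OF that] by (simp add: P_def cumul_cmult)
  ultimately obtain p0 where p0: "integrable lborel p0"
      "\<And>s t. s \<le> t \<Longrightarrow> P t - P s = cumul p0 t - cumul p0 s"
    using mono_AC_density[OF iM2, of P] by blast
  \<comment> \<open>Since \<open>P = cumul M + F\<close>, the density of \<open>F\<close> is \<open>p0 - M\<close>.\<close>
  define c where "c = F 0 - cumul p0 0 + cumul M 0"
  have Feq: "cumul p0 t - cumul M t + c = F t" for t
    unfolding c_def
    using p0(2)[of t 0] p0(2)[of 0 t] by (cases "t \<le> 0") (auto simp: P_def)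
  have dF: "AE t in lborel. (F has_real_derivative (p0 t - M t)) (at t)"
    using cumul_has_real_derivative[OF p0(1)] cumul_has_real_derivative[OF M(1)]
  proof eventually_elim
    case (elim t)
    have "((\<lambda>t. cumul p0 t - cumul M t + c) has_real_derivative (p0 t - M t)) (at t)"
      using elim by (auto intro!: derivative_eq_intros)
    then show ?case unfolding Feq .
  qed
  define p where "p = (\<lambda>x. max (- M x) (min (M x) (p0 x - M x)))"
  have bp: "\<bar>p x\<bar> \<le> M x" for x using M(2)[of x] by (auto simp: p_def)
  have [measurable]: "p0 \<in> borel_measurable borel" "M \<in> borel_measurable borel" using p0(1) M(1) by auto
  have ip: "integrable lborel p"
    by (rule Bochner_Integration.integrable_bound[OF M(1)]) (use bp M(2) in \<open>auto simp: p_def[abs_def]\<close>)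
  have eq: "AE t in lborel. p t = p0 t - M t"
    using dF cumul_has_real_derivative[OF M(1)]
  proof eventually_elim
    case (elim t)
    have "\<bar>p0 t - M t\<bar> \<le> M t"
    proof (rule tendsto_le[of "at t"])
      show "((\<lambda>s. (cumul M s - cumul M t) / (s - t)) \<longlongrightarrow> M t) (at t)"
        using elim by (simp add: has_field_derivative_iff)
      show "((\<lambda>s. \<bar>(F s - F t) / (s - t)\<bar>) \<longlongrightarrow> \<bar>p0 t - M t\<bar>) (at t)"
        using elim by (intro tendsto_rabs) (simp add: has_field_derivative_iff)
      have "\<bar>(F s - F t) / (s - t)\<bar> \<le> (cumul M s - cumul M t) / (s - t)" if "s \<noteq> t" for s
      proof (cases "t < s")
        case True
        then show ?thesis using F[of t s] by (simp add: divide_right_mono)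
      next
        case False
        then have "s < t" using that by simp
        then have "\<bar>(F s - F t) / (s - t)\<bar> = \<bar>F t - F s\<bar> / (t - s)"
          by (simp add: abs_divide abs_minus_commute)
        also have "\<dots> \<le> (cumul M t - cumul M s) / (t - s)"
          using F[of s t] \<open>s < t\<close> by (simp add: divide_right_mono)
        also have "\<dots> = (cumul M s - cumul M t) / (s - t)"
          by (metis minus_diff_eq minus_divide_divide)
        finally show ?thesis .
      qed
      then show "\<forall>\<^sub>F s in at t. \<bar>(F s - F t) / (s - t)\<bar> \<le> (cumul M s - cumul M t) / (s - t)"
        by (auto simp: eventually_at_filter)
    qed auto
    then show ?case by (auto simp: p_def)
  qed
  show ?thesis
  proof (rule that[OF ip _ _ bp])
    show "AE t in lborel. (F has_real_derivative p t) (at t)"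
      using dF eq by eventually_elim simp
    have "cumul p t = cumul (\<lambda>x. p0 x - M x) t" for t
      unfolding cumul_def set_lebesgue_integral_def
      by (rule integral_cong_AE) (use eq in \<open>auto simp: p_def[abs_def]\<close>)
    also have "cumul (\<lambda>x. p0 x - M x) t = cumul p0 t - cumul M t" for t
      unfolding cumul_def using p0(1) M(1) by (intro set_integral_diff) (auto intro: set_integrable_of_integrable)
    finally show "F t - F s = cumul p t - cumul p s" for s t
      using Feq[of t, symmetric] Feq[of s, symmetric] by simp
  qed
qed

section \<open>Existence of the metric speed\<close>

text \<open>Existence of the metric speed \<open>v\<close> at \<open>t\<close> for a curve defined on the whole line; at interior
  points of an interval this agrees with the speed of the curve on that interval.\<close>
definition has_speed :: "(real \<Rightarrow> 'a::metric_space) \<Rightarrow> real \<Rightarrow> real \<Rightarrow> bool" where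
  "has_speed y v t \<longleftrightarrow> ((\<lambda>s. dist (y s) (y t) / \<bar>s - t\<bar>) \<longlongrightarrow> v) (at t)"

lemma abs_dist_diff: "\<bar>dist a c - dist b c\<bar> \<le> dist a (b::'a::metric_space)"
  by (smt (verit) dist_commute dist_triangle)

text \<open>The distances \<open>g n\<close> of the curve to the countably many points \<open>y (q n)\<close>, \<open>q n\<close> rational, are
  absolutely continuous with densities \<open>p n\<close>.  The speed is \<open>w = sup\<^sub>n \<bar>p n\<bar>\<close>: it is at least
  each \<open>\<bar>p n\<bar>\<close> because \<open>g n\<close> is 1-Lipschitz along the curve, and at most \<open>w\<close> because, the points
  \<open>y (q n)\<close> being dense in the curve, \<open>d(y\<^sub>t, y\<^sub>s) \<le> \<integral>\<^sub>s\<^sup>t w\<close>.\<close>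
lemma AE_has_speed:
  fixes y :: "real \<Rightarrow> 'a::metric_space"
  assumes M: "integrable lborel M" "\<And>x. 0 \<le> M x"
    and y: "\<And>s t. s \<le> t \<Longrightarrow> dist (y t) (y s) \<le> cumul M t - cumul M s"
  shows "AE t in lborel. \<exists>v. has_speed y v t"
proof -
  define q where "q = from_nat_into (\<rat> :: real set)"
  have rq: "range q = \<rat>"
    unfolding q_def by (rule range_from_nat_into) (auto simp: countable_rat)
  define g where "g = (\<lambda>n t. dist (y t) (y (q n)))"
  have gy: "\<bar>g n t - g n s\<bar> \<le> dist (y t) (y s)" for n s t
    unfolding g_def by (rule abs_dist_diff)
  have "\<exists>p. integrable lborel p \<and> (\<forall>s t. s \<le> t \<longrightarrow> g n t - g n s = cumul p t - cumul p s) \<and>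
    (AE t in lborel. (g n has_real_derivative p t) (at t)) \<and> (\<forall>x. \<bar>p x\<bar> \<le> M x)" for n
    by (rule AC_density[OF M, of "g n"]) (blast intro: order_trans[OF gy y])+
  then obtain p where ip: "\<And>n. integrable lborel (p n)"
    and gp: "\<And>n s t. s \<le> t \<Longrightarrow> g n t - g n s = cumul (p n) t - cumul (p n) s"
    and dp: "\<And>n. AE t in lborel. (g n has_real_derivative p n t) (at t)"
    and bp: "\<And>n x. \<bar>p n x\<bar> \<le> M x"
    by metis
  have [measurable]: "p n \<in> borel_measurable borel" for n using ip[of n] by auto
  define w where "w = (\<lambda>x. SUP n. \<bar>p n x\<bar>)"
  have bdd: "bdd_above (range (\<lambda>n. \<bar>p n x\<bar>))" for x
    using bp by (auto simp: bdd_above_def)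
  have pw: "\<bar>p n x\<bar> \<le> w x" for n x
    unfolding w_def by (rule cSUP_upper[OF _ bdd]) simp
  have wM: "w x \<le> M x" for x
    unfolding w_def by (rule cSUP_least) (use bp in auto)
  have w0: "0 \<le> w x" for x using pw[of 0 x] by linarith
  have mw: "w \<in> borel_measurable borel"
    unfolding w_def by (rule borel_measurable_cSUP) (auto intro: bdd)
  have iw: "integrable lborel w"
    by (rule Bochner_Integration.integrable_bound[OF M(1)]) (use wM w0 M(2) mw in auto)
  have gw: "\<bar>g n t - g n s\<bar> \<le> cumul w t - cumul w s" if "s \<le> t" for n s t
  proof -
    have "cumul (p n) t - cumul (p n) s \<le> cumul w t - cumul w s"
      using pw[of n] by (intro cumul_diff_mono[OF ip iw _ that]) (simp add: abs_le_iff)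
    moreover have "cumul (\<lambda>x. -1 * p n x) t - cumul (\<lambda>x. -1 * p n x) s \<le> cumul w t - cumul w s"
      using pw[of n] ip by (intro cumul_diff_mono[OF _ iw _ that]) (auto simp: abs_le_iff)
    ultimately show ?thesis using gp[OF that, of n] unfolding cumul_cmult by linarith
  qed
  have cont: "continuous_on UNIV y"
    by (rule continuous_on_of_cumul_bound[OF M(1)]) (use y in auto)
  have yw: "dist (y t) (y s) \<le> cumul w t - cumul w s" if "s \<le> t" for s t
  proof (rule field_le_epsilon)
    fix e :: real assume "e > 0"
    have "isCont y s" using cont by (simp add: continuous_on_eq_continuous_at)
    then obtain d where d: "d > 0" "\<And>u. dist u s < d \<Longrightarrow> dist (y u) (y s) < e / 2"
      using \<open>e > 0\<close> by (metis continuous_at half_gt_zero tendsto_dist_iff continuous_at_eps_delta)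
    obtain u where "u \<in> \<rat>" "s < u" "u < s + d" using Rats_dense_in_real[of s "s + d"] d by auto
    then obtain n where n: "q n = u" using rq by (metis imageE)
    have "dist (y u) (y s) < e / 2" using d \<open>s < u\<close> \<open>u < s + d\<close> by (simp add: dist_real_def)
    moreover have "dist (y t) (y u) - dist (y s) (y u) \<le> cumul w t - cumul w s"
      using gw[OF that, of n] by (simp add: g_def n)
    moreover have "dist (y t) (y s) \<le> dist (y t) (y u) + dist (y u) (y s)" by (rule dist_triangle)
    ultimately show "dist (y t) (y s) \<le> cumul w t - cumul w s + e" by (simp add: dist_commute)
  qed
  have "AE t in lborel. \<forall>n. (g n has_real_derivative p n t) (at t)"
    using dp by (simp add: AE_all_countable)
  with cumul_has_real_derivative[OF iw] show ?thesis
  proof eventually_elim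
    case (elim t)
    have "has_speed y (w t) t"
      unfolding has_speed_def
    proof (rule order_tendstoI)
      fix a assume "w t < a"
      have "((\<lambda>s. (cumul w s - cumul w t) / (s - t)) \<longlongrightarrow> w t) (at t)"
        using elim by (simp add: has_field_derivative_iff)
      then have "\<forall>\<^sub>F s in at t. (cumul w s - cumul w t) / (s - t) < a"
        using \<open>w t < a\<close> by (rule order_tendstoD)
      moreover have "\<forall>\<^sub>F s in at t. s \<noteq> t" by (simp add: eventually_at_filter)
      ultimately show "\<forall>\<^sub>F s in at t. dist (y s) (y t) / \<bar>s - t\<bar> < a"
      proof eventually_elim
        case (elim s)
        have "dist (y s) (y t) / \<bar>s - t\<bar> \<le> (cumul w s - cumul w t) / (s - t)"
        proof (cases "t < s")
          case True
          then show ?thesis using yw[of t s] by (simp add: divide_right_mono)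
        next
          case False
          then have "s < t" using elim by simp
          then have "dist (y s) (y t) / \<bar>s - t\<bar> \<le> (cumul w t - cumul w s) / (t - s)"
            using yw[of s t] by (simp add: divide_right_mono dist_commute)
          also have "\<dots> = (cumul w s - cumul w t) / (s - t)"
            by (metis minus_diff_eq minus_divide_divide)
          finally show ?thesis .
        qed
        then show ?case using elim by linarith
      qed
    next
      fix a assume "a < w t"
      then obtain n where n: "a < \<bar>p n t\<bar>"
        unfolding w_def by (subst (asm) less_cSUP_iff[OF _ bdd]) auto
      have "((\<lambda>s. \<bar>(g n s - g n t) / (s - t)\<bar>) \<longlongrightarrow> \<bar>p n t\<bar>) (at t)"
        using elim by (intro tendsto_rabs) (simp add: has_field_derivative_iff)
      then have "\<forall>\<^sub>F s in at t. a < \<bar>(g n s - g n t) / (s - t)\<bar>"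
        using n by (rule order_tendstoD)
      then show "\<forall>\<^sub>F s in at t. a < dist (y s) (y t) / \<bar>s - t\<bar>"
      proof eventually_elim
        case (elim s)
        have "\<bar>(g n s - g n t) / (s - t)\<bar> \<le> dist (y s) (y t) / \<bar>s - t\<bar>"
          unfolding abs_divide by (rule divide_right_mono[OF gy]) simp
        then show ?case using elim by linarith
      qed
    qed
    then show ?case ..
  qed
qed

text \<open>Freezing a curve on \<open>[a,b]\<close> at its endpoint values extends it to the whole line with the same
  control.\<close>
lemma clamp_cumul_bound:
  fixes y :: "real \<Rightarrow> 'a::metric_space"
  assumes M: "integrable lborel M" "\<And>x. 0 \<le> M x" and "a \<le> b"
    and y: "\<And>s t. a \<le> s \<Longrightarrow> s \<le> t \<Longrightarrow> t \<le> b \<Longrightarrow> dist (y t) (y s) \<le> cumul M t - cumul M s"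
    and "s \<le> t"
  shows "dist (y (max a (min b t))) (y (max a (min b s))) \<le> cumul M t - cumul M s"
proof (cases "s \<le> b \<and> a \<le> t")
  case True
  have "dist (y (max a (min b t))) (y (max a (min b s))) \<le> cumul M (max a (min b t)) - cumul M (max a (min b s))"
    by (rule y) (use assms in auto)
  moreover have "cumul M (max a (min b t)) \<le> cumul M t" "cumul M s \<le> cumul M (max a (min b s))"
    using True assms by (auto intro!: cumul_mono M)
  ultimately show ?thesis by linarith
next
  case False
  then have "max a (min b t) = max a (min b s)" using assms by auto
  then show ?thesis using cumul_mono[OF M \<open>s \<le> t\<close>] by simp
qed

lemma AE_has_speed_interval:
  fixes y :: "real \<Rightarrow> 'a::metric_space"
  assumes M: "integrable lborel M" "\<And>x. 0 \<le> M x" and "a \<le> b"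
    and y: "\<And>s t. a \<le> s \<Longrightarrow> s \<le> t \<Longrightarrow> t \<le> b \<Longrightarrow> dist (y t) (y s) \<le> cumul M t - cumul M s"
  shows "AE t in lborel. a < t \<and> t < b \<longrightarrow> (\<exists>v. has_speed y v t)"
proof -
  define Y where "Y = (\<lambda>t. y (max a (min b t)))"
  have "AE t in lborel. \<exists>v. has_speed Y v t"
    by (rule AE_has_speed[OF M]) (unfold Y_def, rule clamp_cumul_bound[OF assms])
  then show ?thesis
  proof eventually_elim
    case (elim t)
    have "has_speed y v t" if "has_speed Y v t" "a < t" "t < b" for v
      unfolding has_speed_def
      by (rule Lim_transform_within_open[OF that(1)[unfolded has_speed_def], of "{a<..<b}"])
        (use that in \<open>auto simp: Y_def\<close>)
    then show ?case using elim by blast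
  qed
qed

lemma AE_has_derivative_interval:
  fixes h :: "real \<Rightarrow> real"
  assumes M: "integrable lborel M" "\<And>x. 0 \<le> M x" and "a \<le> b"
    and h: "\<And>s t. a \<le> s \<Longrightarrow> s \<le> t \<Longrightarrow> t \<le> b \<Longrightarrow> dist (h t) (h s) \<le> cumul M t - cumul M s"
  shows "AE t in lborel. a < t \<and> t < b \<longrightarrow> (\<exists>D. (h has_real_derivative D) (at t))"
proof -
  define H where "H = (\<lambda>t. h (max a (min b t)))"
  obtain p where "AE t in lborel. (H has_real_derivative p t) (at t)"
    by (rule AC_density[OF M, of H])
      (use clamp_cumul_bound[OF assms] in \<open>auto simp: H_def dist_real_def\<close>)
  then show ?thesis
  proof eventually_elim
    case (elim t)
    have "(h has_real_derivative p t) (at t)" if "a < t" "t < b"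
      by (rule has_field_derivative_transform_within_open[OF elim, of "{a<..<b}"])
        (use that in \<open>auto simp: H_def\<close>)
    then show ?case by blast
  qed
qed

text \<open>On a compact subinterval the Lebesgue measurable integrand of \<^const>\<open>AC1_loc\<close> may be replaced by
  a nonnegative Borel function that is integrable on the whole line.\<close>
lemma AC1_loc_control:
  fixes z :: "real \<Rightarrow> 'a::metric_space"
  assumes "AC1_loc J z" "{a..b} \<subseteq> J"
  obtains M where "integrable lborel M" "\<And>x. 0 \<le> M x"
    "\<And>s t. a \<le> s \<Longrightarrow> s \<le> t \<Longrightarrow> t \<le> b \<Longrightarrow> dist (z t) (z s) \<le> cumul M t - cumul M s"
proof -
  obtain m where m: "\<And>K. compact K \<Longrightarrow> K \<subseteq> J \<Longrightarrow> m absolutely_integrable_on K"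
    "\<And>s t. s \<in> J \<Longrightarrow> t \<in> J \<Longrightarrow> s < t \<Longrightarrow> dist (z t) (z s) \<le> (LINT u:{s..t}|lebesgue. m u)"
    using assms(1) unfolding AC1_loc_def by metis
  define f0 where "f0 = (\<lambda>u. indicator {a..b} u * m u)"
  have if0: "integrable lebesgue f0"
    using m(1)[of "{a..b}"] assms(2) by (simp add: set_integrable_def f0_def)
  obtain g where g: "g \<in> borel_measurable lborel" "AE x in lborel. f0 x = g x"
    using completion_ex_borel_measurable_real[OF borel_measurable_integrable[OF if0]] by blast
  have g': "AE x in lebesgue. f0 x = g x" using g(2) by (simp add: AE_completion)
  have "integrable lebesgue g"
    using integrable_cong_AE_imp[OF if0 measurable_completion[OF g(1)]] g' by (auto elim!: eventually_mono)
  then have ig: "integrable lborel g" using g(1) by (simp add: integrable_completion)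
  define M where "M = (\<lambda>x. \<bar>g x\<bar>)"
  have iM: "integrable lborel M" using ig by (simp add: M_def)
  show ?thesis
  proof (rule that[OF iM])
    show "0 \<le> M x" for x by (simp add: M_def)
    show "dist (z t) (z s) \<le> cumul M t - cumul M s" if st: "a \<le> s" "s \<le> t" "t \<le> b" for s t
    proof (cases "s = t")
      case False
      then have "dist (z t) (z s) \<le> (LINT u:{s..t}|lebesgue. m u)"
        using assms(2) st by (intro m(2)) auto
      also have "\<dots> = (LINT u|lebesgue. indicator {s..t} u * g u)"
        unfolding set_lebesgue_integral_def
      proof (rule integral_cong_AE)
        show "(\<lambda>u. indicator {s..t} u * g u) \<in> borel_measurable lebesgue"
          using measurable_completion[OF g(1)] by (intro borel_measurable_times borel_measurable_indicator) auto
        have "(\<lambda>u. indicator {s..t} u *\<^sub>R m u) = (\<lambda>u. indicator {s..t} u * f0 u)"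
          using st by (auto simp: f0_def indicator_def)
        moreover have "(\<lambda>u. indicator {s..t} u * f0 u) \<in> borel_measurable lebesgue"
          using borel_measurable_integrable[OF if0] by (intro borel_measurable_times borel_measurable_indicator) auto
        ultimately show "(\<lambda>u. indicator {s..t} u *\<^sub>R m u) \<in> borel_measurable lebesgue" by simp
        show "AE u in lebesgue. indicator {s..t} u *\<^sub>R m u = indicator {s..t} u * g u"
          using g' by eventually_elim (use st in \<open>auto simp: f0_def indicator_def\<close>)
      qed
      also have "\<dots> = (LINT u|lborel. indicator {s..t} u * g u)"
        using g(1) by (intro integral_completion borel_measurable_times) auto
      also have "\<dots> \<le> (LINT u:{s..t}|lborel. M u)"
        unfolding set_lebesgue_integral_def
        by (rule integral_mono) (use set_integrable_of_integrable[OF ig, of "{s..t}"]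
          set_integrable_of_integrable[OF iM, of "{s..t}"] in \<open>auto simp: set_integrable_def M_def indicator_def\<close>)
      also have "\<dots> = cumul M t - cumul M s"
        unfolding cumul_diff_integral[OF iM st(2)]
        by (rule set_borel_integral_eq_integral(2)[OF set_integrable_of_integrable[OF iM]]) simp
      finally show ?thesis .
    qed simp
  qed
qed

section \<open>Rates along a curve of maximal slope\<close>

lemma cumul_indicator:
  assumes "a \<le> s" "s \<le> t" "t \<le> b"
  shows "cumul (indicator {a..b}) t - cumul (indicator {a..b}) s = t - s"
proof -
  have "cumul (indicator {a..b}) t - cumul (indicator {a..b}) s = integral {s..t} (indicator {a..b})"
    by (rule cumul_diff_integral) (use assms in auto)
  also have "\<dots> = integral {s..t} (\<lambda>x. 1::real)"
    by (rule integral_cong) (use assms in auto)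
  finally show ?thesis using assms by simp
qed

text \<open>The common form of all integrated estimates: the pointwise bound
  \<open>(\<phi> \<circ> h)' + k v \<le> c\<close> for almost every time implies the corresponding bound for increments.  Here
  \<open>t \<mapsto> d(y\<^sub>t, y\<^sub>a)\<close> has right upper Dini derivative at most the speed \<open>v\<close>.\<close>
lemma rate_inequality:
  fixes y :: "real \<Rightarrow> 'a::metric_space" and h \<phi> :: "real \<Rightarrow> real"
  assumes ab: "a \<le> b" and M: "integrable lborel M" "\<And>x. 0 \<le> M x"
    and y: "\<And>s t. a \<le> s \<Longrightarrow> s \<le> t \<Longrightarrow> t \<le> b \<Longrightarrow> dist (y t) (y s) \<le> cumul M t - cumul M s"
    and h: "\<And>s t. a \<le> s \<Longrightarrow> s \<le> t \<Longrightarrow> t \<le> b \<Longrightarrow> \<bar>h t - h s\<bar> \<le> cumul M t - cumul M s"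
    and lip: "\<And>s t. s \<in> {a..b} \<Longrightarrow> t \<in> {a..b} \<Longrightarrow> \<bar>\<phi> (h t) - \<phi> (h s)\<bar> \<le> L * \<bar>h t - h s\<bar>"
    and L: "0 \<le> L" and k: "0 \<le> k"
    and AE: "AE t in lborel. a < t \<and> t < b \<longrightarrow> (\<exists>v D p. has_speed y v t \<and> (h has_real_derivative D) (at t) \<and>
        (\<phi> has_real_derivative p) (at (h t)) \<and> p * D + k * v \<le> c)"
  shows "\<phi> (h b) + k * dist (y b) (y a) \<le> \<phi> (h a) + c * (b - a)"
proof -
  define F where "F = (\<lambda>t. \<phi> (h t) + k * dist (y t) (y a) - c * t)"
  \<comment> \<open>The last summand accounts for the linear term \<open>c * t\<close>.\<close>
  define M' where "M' = (\<lambda>x. (L + k) * M x + \<bar>c\<bar> * indicator {a..b} x)"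
  have i1: "integrable lborel (\<lambda>x. (L + k) * M x)" using M by simp
  have "integrable lborel (indicator {a..b} :: real \<Rightarrow> real)" using ab by auto
  then have i2: "integrable lborel (\<lambda>x. \<bar>c\<bar> * indicator {a..b} x)" by (rule integrable_mult_right)
  have iM': "integrable lborel M'" unfolding M'_def using i1 i2 by simp
  have "F b \<le> F a"
  proof (rule decreasing_of_Dini_nonpos_AE[OF ab iM'])
    show "0 \<le> M' x" for x using M L k by (simp add: M'_def)
    show "\<bar>F t - F s\<bar> \<le> cumul M' t - cumul M' s" if st: "a \<le> s" "s \<le> t" "t \<le> b" for s t
    proof -
      have "cumul M' u = (L + k) * cumul M u + \<bar>c\<bar> * cumul (indicator {a..b}) u" for u
        unfolding M'_def cumul_add[OF i1 i2] cumul_cmult ..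
      then have "cumul M' t - cumul M' s = (L + k) * (cumul M t - cumul M s)
          + \<bar>c\<bar> * (cumul (indicator {a..b}) t - cumul (indicator {a..b}) s)"
        by (simp add: algebra_simps)
      then have eq: "cumul M' t - cumul M' s = (L + k) * (cumul M t - cumul M s) + \<bar>c\<bar> * (t - s)"
        unfolding cumul_indicator[OF st] .
      have "\<bar>\<phi> (h t) - \<phi> (h s)\<bar> \<le> L * (cumul M t - cumul M s)"
        using lip[of s t] mult_left_mono[OF h[OF st] L] st by auto
      moreover have "\<bar>dist (y t) (y a) - dist (y s) (y a)\<bar> \<le> cumul M t - cumul M s"
        using abs_dist_diff y[OF st] by (rule order_trans)
      then have "\<bar>k * dist (y t) (y a) - k * dist (y s) (y a)\<bar> \<le> k * (cumul M t - cumul M s)"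
        using k by (metis abs_mult abs_of_nonneg mult_left_mono right_diff_distrib)
      moreover have "\<bar>c * t - c * s\<bar> = \<bar>c\<bar> * (t - s)"
        using st by (metis abs_mult abs_of_nonneg diff_ge_0_iff_ge right_diff_distrib)
      ultimately show ?thesis unfolding eq F_def distrib_right by linarith
    qed
    show "AE t in lborel. a < t \<and> t < b \<longrightarrow>
        (\<forall>\<epsilon>>0. \<forall>\<^sub>F s in at_right t. F s - F t \<le> \<epsilon> * (s - t))"
      using AE
    proof (eventually_elim, intro impI allI)
      fix t \<epsilon> :: real
      assume ex: "a < t \<and> t < b \<longrightarrow> (\<exists>v D p. has_speed y v t \<and> (h has_real_derivative D) (at t) \<and>
          (\<phi> has_real_derivative p) (at (h t)) \<and> p * D + k * v \<le> c)" and t: "a < t \<and> t < b" and "\<epsilon> > 0"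
      then obtain v D p where vD: "has_speed y v t" "(h has_real_derivative D) (at t)"
        "(\<phi> has_real_derivative p) (at (h t))" and le: "p * D + k * v \<le> c" by blast
      define e where "e = \<epsilon> / (1 + k)"
      have e0: "e > 0" "(1 + k) * e = \<epsilon>" using \<open>\<epsilon> > 0\<close> k by (auto simp: e_def)
      then have e: "e > 0" "e + k * e = \<epsilon>" by (auto simp: distrib_right)
      have "((\<lambda>s. \<phi> (h s)) has_real_derivative p * D) (at t)"
        using vD(3,2) by (rule DERIV_chain2)
      then have "((\<lambda>s. (\<phi> (h s) - \<phi> (h t)) / (s - t)) \<longlongrightarrow> p * D) (at t)"
        by (simp add: has_field_derivative_iff)
      then have "\<forall>\<^sub>F s in at t. (\<phi> (h s) - \<phi> (h t)) / (s - t) < p * D + e"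
        by (rule order_tendstoD) (use e in simp)
      then have 1: "\<forall>\<^sub>F s in at_right t. (\<phi> (h s) - \<phi> (h t)) / (s - t) < p * D + e"
        by (rule filter_leD[OF at_le, rotated]) simp
      have "\<forall>\<^sub>F s in at t. dist (y s) (y t) / \<bar>s - t\<bar> < v + e"
        using vD(1) unfolding has_speed_def by (rule order_tendstoD) (use e in simp)
      then have 2: "\<forall>\<^sub>F s in at_right t. dist (y s) (y t) / \<bar>s - t\<bar> < v + e"
        by (rule filter_leD[OF at_le, rotated]) simp
      have 3: "\<forall>\<^sub>F s in at_right t. t < s" by (rule eventually_at_right_less)
      show "\<forall>\<^sub>F s in at_right t. F s - F t \<le> \<epsilon> * (s - t)"
        using 1 2 3
      proof eventually_elim
        case (elim s)
        have "\<phi> (h s) - \<phi> (h t) \<le> (p * D + e) * (s - t)"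
          using elim by (simp add: pos_divide_less_eq)
        moreover have "dist (y s) (y t) \<le> (v + e) * (s - t)"
          using elim by (simp add: pos_divide_less_eq)
        then have "dist (y s) (y a) - dist (y t) (y a) \<le> (v + e) * (s - t)"
          using abs_dist_diff[of "y s" "y a" "y t"] by linarith
        then have "k * dist (y s) (y a) - k * dist (y t) (y a) \<le> k * ((v + e) * (s - t))"
          using k by (metis mult_left_mono right_diff_distrib)
        moreover have "(p * D + k * v) * (s - t) \<le> c * (s - t)"
          using le elim by (intro mult_right_mono) auto
        moreover have "\<epsilon> * (s - t) = e * (s - t) + k * e * (s - t)"
          using e(2) by (metis distrib_right)
        ultimately show ?case unfolding F_def by (simp add: algebra_simps)
      qed
    qed
  qed
  then show ?thesis by (simp add: F_def algebra_simps)
qed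

lemma C1_lipschitz:
  fixes \<phi> :: "real \<Rightarrow> real"
  assumes d: "\<And>u. u \<in> {c..C} \<Longrightarrow> (\<phi> has_real_derivative \<phi>' u) (at u)"
    and cont: "continuous_on {c..C} \<phi>'"
  obtains L where "0 \<le> L" "\<And>u w. u \<in> {c..C} \<Longrightarrow> w \<in> {c..C} \<Longrightarrow> \<bar>\<phi> u - \<phi> w\<bar> \<le> L * \<bar>u - w\<bar>"
proof -
  have "bounded (\<phi>' ` {c..C})" using compact_continuous_image[OF cont] compact_imp_bounded by blast
  then obtain L where L: "L > 0" "\<And>u. u \<in> {c..C} \<Longrightarrow> \<bar>\<phi>' u\<bar> \<le> L"
    unfolding bounded_pos by auto
  have "\<bar>\<phi> u - \<phi> w\<bar> \<le> L * \<bar>u - w\<bar>" if "u \<in> {c..C}" "w \<in> {c..C}" for u w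
    using field_differentiable_bound[of "{c..C}" \<phi> \<phi>' L u w] L d that
    by (auto intro: has_field_derivative_at_within)
  then show ?thesis using that[of L] L by simp
qed

lemma has_speed_nonneg: "has_speed y v t \<Longrightarrow> 0 \<le> v"
  unfolding has_speed_def by (rule tendsto_lowerbound[where F="at t"]) auto

lemma has_speed_tendsto:
  assumes "has_speed y v t" shows "((\<lambda>s. dist (y s) (y t)) \<longlongrightarrow> 0) (at t)"
proof -
  have "((\<lambda>s. dist (y s) (y t) / \<bar>s - t\<bar> * \<bar>s - t\<bar>) \<longlongrightarrow> v * \<bar>t - t\<bar>) (at t)"
    using assms unfolding has_speed_def by (intro tendsto_intros)
  then have "((\<lambda>s. dist (y s) (y t) / \<bar>s - t\<bar> * \<bar>s - t\<bar>) \<longlongrightarrow> 0) (at t)" by simp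
  then show ?thesis
    by (rule Lim_transform_eventually) (auto simp: eventually_at_filter)
qed

lemma slope_bound:
  fixes f :: "'a::metric_space \<Rightarrow> ereal"
  assumes "slope f x = ereal S" "S < S'"
  shows "eventually (\<lambda>z. neg_part (f z - f x) / ereal (dist z x) < ereal S') (at x)"
proof (cases "x isolated_in UNIV")
  case True
  then have "at x = bot" by (auto simp: isolated_in_def at_eq_bot_iff)
  then show ?thesis by simp
next
  case False
  then have "Limsup (at x) (\<lambda>z. neg_part (f z - f x) / ereal (dist z x)) < ereal S'"
    using assms unfolding slope_def by (auto split: if_splits)
  then show ?thesis by (rule Limsup_lessD)
qed

text \<open>The chain rule inequality: it compares \<open>f (y s)\<close> with
  \<open>f (y t)\<close> through the definition of the slope as a limes superior.\<close>
lemma energy_decrease_le_slope_speed: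
  fixes f :: "'a::metric_space \<Rightarrow> ereal"
  assumes v: "has_speed y v t" and D: "((\<lambda>s. real_of_ereal (f (y s))) has_real_derivative D) (at t)"
    and fin: "\<forall>\<^sub>F s in at t. \<bar>f (y s)\<bar> \<noteq> \<infinity>" "\<bar>f (y t)\<bar> \<noteq> \<infinity>"
    and S: "slope f (y t) = ereal S"
  shows "- D \<le> S * v"
proof -
  define h where "h = (\<lambda>s. real_of_ereal (f (y s)))"
  have main: "- D \<le> S' * v" if "S < S'" for S'
  proof -
    from slope_bound[OF S that] obtain d where d: "d > 0"
      "\<And>z. z \<noteq> y t \<Longrightarrow> dist z (y t) < d \<Longrightarrow> neg_part (f z - f (y t)) / ereal (dist z (y t)) < ereal S'"
      by (auto simp: eventually_at)
    have "\<forall>\<^sub>F s in at t. dist (y s) (y t) < d"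
      using has_speed_tendsto[OF v] d(1) by (rule order_tendstoD)
    with fin(1) have "\<forall>\<^sub>F s in at t. h t - h s \<le> S' * dist (y s) (y t)"
    proof eventually_elim
      case (elim s)
      show ?case
      proof (cases "y s = y t")
        case True then show ?thesis by (simp add: h_def)
      next
        case False
        have fs: "f (y s) = ereal (h s)" "f (y t) = ereal (h t)"
          using elim fin(2) by (auto simp: h_def ereal_real)
        define m where "m = max (h t - h s) 0"
        have "neg_part (f (y s) - f (y t)) = ereal m"
          unfolding neg_part_def fs by (simp add: m_def max_def)
        then have "m / dist (y s) (y t) < S'"
          using d(2)[OF False elim(2)] False by simp
        then have "m < S' * dist (y s) (y t)"
          using False by (simp add: pos_divide_less_eq)
        moreover have "h t - h s \<le> m" by (simp add: m_def)
        ultimately show ?thesis by simp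
      qed
    qed
    then have "\<forall>\<^sub>F s in at_right t. h t - h s \<le> S' * dist (y s) (y t)"
      by (rule filter_leD[OF at_le, rotated]) simp
    then have ev: "\<forall>\<^sub>F s in at_right t. - ((h s - h t) / (s - t)) \<le> S' * (dist (y s) (y t) / \<bar>s - t\<bar>)"
      using eventually_at_right_less
    proof eventually_elim
      case (elim s)
      have "- ((h s - h t) / (s - t)) = (h t - h s) / (s - t)" by (metis minus_diff_eq minus_divide_left)
      also have "\<dots> \<le> S' * dist (y s) (y t) / (s - t)" using elim by (intro divide_right_mono) auto
      finally show ?case using elim by simp
    qed
    show ?thesis
    proof (rule tendsto_le[OF _ _ _ ev])
      have "((\<lambda>s. (h s - h t) / (s - t)) \<longlongrightarrow> D) (at t)"
        using D unfolding h_def by (simp add: has_field_derivative_iff)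
      then show "((\<lambda>s. - ((h s - h t) / (s - t))) \<longlongrightarrow> - D) (at_right t)"
        by (intro tendsto_minus) (rule tendsto_mono[OF at_le], auto)
      show "((\<lambda>s. S' * (dist (y s) (y t) / \<bar>s - t\<bar>)) \<longlongrightarrow> S' * v) (at_right t)"
        using v unfolding has_speed_def by (intro tendsto_mult_left) (rule tendsto_mono[OF at_le], auto)
    qed simp
  qed
  show ?thesis
  proof (rule field_le_epsilon)
    fix e :: real assume "e > 0"
    have v0: "0 \<le> v" by (rule has_speed_nonneg[OF v])
    have "- D \<le> (S + e / (v + 1)) * v" using v0 \<open>e > 0\<close> by (intro main) simp
    also have "\<dots> = S * v + e * (v / (v + 1))" by (simp add: algebra_simps)
    also have "\<dots> \<le> S * v + e * 1" using v0 \<open>e > 0\<close> by (intro add_left_mono mult_left_mono) auto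
    finally show "- D \<le> S * v + e" by simp
  qed
qed

text \<open>With \<open>S\<close> the slope at \<open>y t\<close>, equality in Young's inequality gives \<open>v = S\<close> and \<open>D = -S\<^sup>2\<close>;
  both bounds then follow from \<open>p S \<ge> 1\<close>, which is Condition (A) when \<open>p = \<theta>'(h)\<close>.\<close>
lemma dissipation_pointwise:
  fixes f :: "'a::metric_space \<Rightarrow> ereal"
  assumes v: "has_speed y v t" and D: "((\<lambda>s. real_of_ereal (f (y s))) has_real_derivative D) (at t)"
    and fin: "\<forall>\<^sub>F s in at t. \<bar>f (y s)\<bar> \<noteq> \<infinity>" "\<bar>f (y t)\<bar> \<noteq> \<infinity>"
    and ineq: "ereal (1/2 * v\<^sup>2) + ereal (1/2) * (slope f (y t))\<^sup>2 \<le> ereal (- D)"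
    and p: "0 < p" "1 \<le> ereal p * slope f (y t)"
  shows "p * D + v \<le> 0" "p\<^sup>2 * D \<le> - 1"
proof -
  obtain S where S: "slope f (y t) = ereal S"
  proof (cases "slope f (y t)")
    case PInf
    then show ?thesis using ineq by (simp add: power2_eq_square)
  next
    case MInf
    then show ?thesis using p by simp
  qed
  have pS: "1 \<le> p * S" using p S by (simp add: one_ereal_def)
  then have "0 < S" using p by (metis less_le_trans zero_less_mult_pos zero_less_one)
  have "1/2 * v\<^sup>2 + 1/2 * S\<^sup>2 \<le> - D" using ineq S by (simp add: power2_eq_square)
  moreover have DS: "- D \<le> S * v" by (rule energy_decrease_le_slope_speed[OF v D fin S])
  ultimately have "(v - S)\<^sup>2 \<le> 0" by (simp add: power2_eq_square algebra_simps)
  then have "v = S" by simp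
  have "S\<^sup>2 \<le> - D" using \<open>1/2 * v\<^sup>2 + 1/2 * S\<^sup>2 \<le> - D\<close> \<open>v = S\<close> by simp
  then have DS2: "D = - S\<^sup>2" using DS \<open>v = S\<close> by (simp add: power2_eq_square)
  have "S * 1 \<le> S * (p * S)" using pS \<open>0 < S\<close> by (intro mult_left_mono) auto
  then show "p * D + v \<le> 0" unfolding DS2 \<open>v = S\<close> by (simp add: power2_eq_square algebra_simps)
  have "1 \<le> (p * S)\<^sup>2" using pS by (simp add: one_le_power)
  then show "p\<^sup>2 * D \<le> - 1" unfolding DS2 by (simp add: power_mult_distrib)
qed

text \<open>The definition of a curve of maximal slope with the conventional values of \<^const>\<open>metric_speed\<close>
  and \<^const>\<open>deriv\<close> replaced by limits that exist, and one common control for \<open>y\<close> and \<open>f \<circ> y\<close>.\<close>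
lemma max_slope_curve_control:
  fixes f :: "'a::metric_space \<Rightarrow> ereal"
  assumes c: "max_slope_curve f (times_below T) y" and b: "b \<in> times_below T"
  obtains M where "integrable lborel M" "\<And>x. 0 \<le> M x"
    "\<And>s t. 0 \<le> s \<Longrightarrow> s \<le> t \<Longrightarrow> t \<le> b \<Longrightarrow> dist (y t) (y s) \<le> cumul M t - cumul M s"
    "\<And>s t. 0 \<le> s \<Longrightarrow> s \<le> t \<Longrightarrow> t \<le> b \<Longrightarrow>
       \<bar>real_of_ereal (f (y t)) - real_of_ereal (f (y s))\<bar> \<le> cumul M t - cumul M s"
    "AE t in lborel. 0 < t \<and> t < b \<longrightarrow> (\<exists>v D. has_speed y v t \<and>
       ((\<lambda>s. real_of_ereal (f (y s))) has_real_derivative D) (at t) \<and>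
       ereal (1/2 * v\<^sup>2) + ereal (1/2) * (slope f (y t))\<^sup>2 \<le> ereal (- D))"
proof -
  define h where "h = (\<lambda>s. real_of_ereal (f (y s)))"
  define J where "J = times_below T"
  have b0: "0 \<le> b" and sub: "{0..b} \<subseteq> J"
    using b by (auto simp: J_def times_below_def intro: le_less_trans[OF ereal_less_eq(3)[THEN iffD2]])
  from c have AC: "AC1_loc J y" "AC1_loc J h"
    and AE: "AE t in lebesgue. t \<in> J \<longrightarrow> ereal (- deriv h t)
          \<ge> ereal (1/2 * (metric_speed J y t)\<^sup>2) + ereal (1/2) * (slope f (y t))\<^sup>2"
    unfolding max_slope_curve_def J_def h_def by auto
  obtain M1 where M1: "integrable lborel M1" "\<And>x. 0 \<le> M1 x"
    "\<And>s t. 0 \<le> s \<Longrightarrow> s \<le> t \<Longrightarrow> t \<le> b \<Longrightarrow> dist (y t) (y s) \<le> cumul M1 t - cumul M1 s"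
    using AC1_loc_control[OF AC(1) sub] by blast
  obtain M2 where M2: "integrable lborel M2" "\<And>x. 0 \<le> M2 x"
    "\<And>s t. 0 \<le> s \<Longrightarrow> s \<le> t \<Longrightarrow> t \<le> b \<Longrightarrow> dist (h t) (h s) \<le> cumul M2 t - cumul M2 s"
    using AC1_loc_control[OF AC(2) sub] by blast
  define M where "M = (\<lambda>x. M1 x + M2 x)"
  have iM: "integrable lborel M" using M1 M2 by (simp add: M_def)
  have cM: "cumul M t = cumul M1 t + cumul M2 t" for t
    unfolding M_def by (rule cumul_add[OF M1(1) M2(1)])
  show ?thesis
  proof (rule that[OF iM])
    show "0 \<le> M x" for x using M1 M2 by (simp add: M_def)
    show "dist (y t) (y s) \<le> cumul M t - cumul M s" if "0 \<le> s" "s \<le> t" "t \<le> b" for s t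
      using M1(3)[OF that] cumul_mono[OF M2(1,2) that(2)] by (simp add: cM)
    show "\<bar>real_of_ereal (f (y t)) - real_of_ereal (f (y s))\<bar> \<le> cumul M t - cumul M s"
      if "0 \<le> s" "s \<le> t" "t \<le> b" for s t
      using M2(3)[OF that] cumul_mono[OF M1(1,2) that(2)] by (simp add: cM h_def dist_real_def)
    have "AE t in lborel. t \<in> J \<longrightarrow> ereal (- deriv h t)
          \<ge> ereal (1/2 * (metric_speed J y t)\<^sup>2) + ereal (1/2) * (slope f (y t))\<^sup>2"
      using AE by (simp add: AE_completion_iff)
    moreover have "AE t in lborel. 0 < t \<and> t < b \<longrightarrow> (\<exists>v. has_speed y v t)"
      by (rule AE_has_speed_interval[OF M1(1,2) b0 M1(3)])
    moreover have "AE t in lborel. 0 < t \<and> t < b \<longrightarrow> (\<exists>D. (h has_real_derivative D) (at t))"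
      by (rule AE_has_derivative_interval[OF M2(1,2) b0 M2(3)])
    ultimately
    show "AE t in lborel. 0 < t \<and> t < b \<longrightarrow> (\<exists>v D. has_speed y v t \<and>
       ((\<lambda>s. real_of_ereal (f (y s))) has_real_derivative D) (at t) \<and>
       ereal (1/2 * v\<^sup>2) + ereal (1/2) * (slope f (y t))\<^sup>2 \<le> ereal (- D))"
    proof (eventually_elim, intro impI)
      fix t assume ineq: "t \<in> J \<longrightarrow> ereal (- deriv h t)
          \<ge> ereal (1/2 * (metric_speed J y t)\<^sup>2) + ereal (1/2) * (slope f (y t))\<^sup>2"
        and "0 < t \<and> t < b \<longrightarrow> (\<exists>v. has_speed y v t)"
        "0 < t \<and> t < b \<longrightarrow> (\<exists>D. (h has_real_derivative D) (at t))"
        and t: "0 < t \<and> t < b"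
      then obtain v D where vD: "has_speed y v t" "(h has_real_derivative D) (at t)" by blast
      have "t \<in> interior J"
        by (rule interiorI[of "{0<..<b}"]) (use t sub in auto)
      then have at: "at t within J = at t" by (rule at_within_interior)
      have speed: "metric_speed J y t = v"
        unfolding metric_speed_def at
        by (rule tendsto_Lim[OF _ vD(1)[unfolded has_speed_def]]) simp
      have deriv: "deriv h t = D" using vD(2) by (rule DERIV_imp_deriv)
      have "t \<in> J" using t sub by auto
      then have "ereal (1/2 * v\<^sup>2) + ereal (1/2) * (slope f (y t))\<^sup>2 \<le> ereal (- D)"
        by (rule ineq[unfolded speed deriv, rule_format])
      then show "\<exists>v D. has_speed y v t \<and>
       ((\<lambda>s. real_of_ereal (f (y s))) has_real_derivative D) (at t) \<and>
       ereal (1/2 * v\<^sup>2) + ereal (1/2) * (slope f (y t))\<^sup>2 \<le> ereal (- D)"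
        using vD[unfolded h_def] by (intro exI[of _ v] exI[of _ D] conjI)
    qed
  qed
qed

lemma dissipation_ineqD:
  assumes "ereal (1/2 * v\<^sup>2) + ereal (1/2) * (S::ereal)\<^sup>2 \<le> ereal (- D)"
  shows "1/2 * v\<^sup>2 \<le> - D"
proof -
  have "0 \<le> S\<^sup>2" by (cases S) (auto simp: power2_eq_square)
  then have "ereal (1/2 * v\<^sup>2) \<le> ereal (1/2 * v\<^sup>2) + ereal (1/2) * S\<^sup>2" by (intro ereal_le_add_self) simp
  then have "ereal (1/2 * v\<^sup>2) \<le> ereal (- D)" using assms by (rule order_trans)
  then show ?thesis by simp
qed

lemma ereal_le_diff_of_forall_less:
  fixes e t :: ereal and g :: real
  assumes "0 < t" "\<And>u. 0 \<le> u \<Longrightarrow> ereal u < t \<Longrightarrow> e \<le> ereal (g - u)"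
  shows "e \<le> ereal g - t"
proof (cases e)
  case (real x)
  have le: "t \<le> ereal (g - x)"
  proof (rule ccontr)
    assume "\<not> t \<le> ereal (g - x)"
    then have "max (ereal (g - x)) 0 < t" using assms(1) by auto
    then obtain u where u: "max (ereal (g - x)) 0 < ereal u" "ereal u < t" using ereal_dense2 by blast
    then have "0 \<le> u" "g - x < u" by (auto simp: zero_ereal_def)
    then show False using assms(2)[of u] u real by simp
  qed
  then show ?thesis using assms(1) real by (cases t) auto
next
  case PInf
  then show ?thesis using assms(2)[of 0] assms(1) by (simp add: zero_ereal_def)
qed simp

section \<open>Parameter functions\<close>

lemma parameter_function_DERIV:
  assumes "parameter_function \<theta>" "0 < u"
  shows "(\<theta> has_real_derivative deriv \<theta> u) (at u)" "0 < deriv \<theta> u"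
  using assms unfolding parameter_function_def by (auto simp: DERIV_deriv_iff_real_differentiable)

lemma parameter_function_strict_mono:
  assumes param: "parameter_function \<theta>" and "0 \<le> u" "u < w"
  shows "\<theta> u < \<theta> w"
proof (rule DERIV_pos_imp_increasing_open[OF \<open>u < w\<close>])
  show "\<exists>y. (\<theta> has_real_derivative y) (at x) \<and> 0 < y" if "u < x" "x < w" for x
    using parameter_function_DERIV[OF param, of x] that \<open>0 \<le> u\<close> by auto
  show "continuous_on {u..w} \<theta>"
    using param \<open>0 \<le> u\<close> unfolding parameter_function_def by (auto elim!: continuous_on_subset)
qed

lemma parameter_function_mono:
  assumes "parameter_function \<theta>" "0 \<le> u" "u \<le> w"
  shows "\<theta> u \<le> \<theta> w"
  using parameter_function_strict_mono[OF assms(1,2), of w] assms(3) by (cases "u = w") auto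

lemma parameter_function_IVT:
  assumes param: "parameter_function \<theta>" and "0 \<le> v" "v \<le> \<theta> w" "0 \<le> w"
  obtains u where "0 \<le> u" "u \<le> w" "\<theta> u = v"
proof -
  have "\<exists>u. 0 \<le> u \<and> u \<le> w \<and> \<theta> u = v"
    by (rule IVT') (use assms in \<open>auto simp: parameter_function_def elim!: continuous_on_subset\<close>)
  then show ?thesis using that by blast
qed

lemma Gam_theta:
  assumes param: "parameter_function \<theta>" and "0 \<le> u"
  shows "Gam \<theta> (\<theta> u) = eta \<theta> u"
proof -
  have "inj_on \<theta> {0..}"
    by (rule linorder_inj_onI) (use parameter_function_strict_mono[OF param] in force)+
  then show ?thesis unfolding Gam_def by (simp add: the_inv_into_f_f \<open>0 \<le> u\<close>)
qed

lemma less_theta_infty: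
  assumes param: "parameter_function \<theta>" and "ereal r < theta_infty \<theta>"
  obtains w where "0 \<le> w" "r < \<theta> w"
proof -
  define L where "L = (SUP u\<in>{0..}. ereal (\<theta> u))"
  have "((\<lambda>u. ereal (\<theta> u)) \<longlongrightarrow> L) at_top"
  proof (rule order_tendstoI)
    fix a assume "a < L"
    then obtain u where u: "0 \<le> u" "a < ereal (\<theta> u)" unfolding L_def less_SUP_iff by auto
    show "\<forall>\<^sub>F x in at_top. a < ereal (\<theta> x)"
      using eventually_ge_at_top[of u]
    proof eventually_elim
      case (elim x)
      then have "ereal (\<theta> u) \<le> ereal (\<theta> x)" using parameter_function_mono[OF param u(1)] by simp
      then show ?case using u(2) by (rule less_le_trans[rotated])
    qed
  next
    fix a assume a: "L < a"
    show "\<forall>\<^sub>F x in at_top. ereal (\<theta> x) < a"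
      using eventually_ge_at_top[of 0]
    proof eventually_elim
      case (elim x)
      then have "ereal (\<theta> x) \<le> L" unfolding L_def by (intro SUP_upper) auto
      then show ?case using a by (rule le_less_trans)
    qed
  qed
  then have "theta_infty \<theta> = L" unfolding theta_infty_def by (intro tendsto_Lim) auto
  then have "ereal r < (SUP u\<in>{0..}. ereal (\<theta> u))" using assms(2) by (simp add: L_def)
  then obtain w where "0 \<le> w" "r < \<theta> w" unfolding less_SUP_iff by auto
  then show ?thesis by (rule that)
qed

lemma eta_mono:
  assumes "u \<le> w"
  shows "eta \<theta> u \<le> eta \<theta> w"
proof -
  define N where "N = (\<lambda>S. \<integral>\<^sup>+ s\<in>S. ennreal ((deriv \<theta> s)\<^sup>2) \<partial>lborel)"
  have N: "enn2ereal (N A) \<le> enn2ereal (N B)" if "A \<subseteq> B" for A B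
    unfolding less_eq_ennreal.rep_eq[symmetric] N_def
    by (intro nn_integral_mono mult_left_mono) (use that in \<open>auto simp: indicator_def\<close>)
  have "- enn2ereal (N A) \<le> enn2ereal (N B)" for A B
    using enn2ereal_nonneg[of "N A"] enn2ereal_nonneg[of "N B"]
    by (meson ereal_uminus_le_0_iff order_trans)
  moreover have "{1<..u} \<subseteq> {1<..w}" "{w<..1} \<subseteq> {u<..1}" using assms by auto
  moreover have "eta \<theta> x = (if 1 \<le> x then enn2ereal (N {1<..x}) else - enn2ereal (N {x<..1}))" for x
    by (simp add: eta_def N_def)
  ultimately show ?thesis
    using N assms by (simp add: ereal_minus_le_minus)
qed

text \<open>On the positive half line \<^const>\<open>eta\<close> is finite and is a primitive of \<open>\<theta>'\<^sup>2\<close>.\<close>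
lemma eta_antiderivative:
  assumes param: "parameter_function \<theta>"
  obtains G where "\<And>u. 0 < u \<Longrightarrow> (G has_real_derivative (deriv \<theta> u)\<^sup>2) (at u)"
    "\<And>u. 0 < u \<Longrightarrow> eta \<theta> u = ereal (G u)"
proof -
  have cont: "continuous_on {0<..} (deriv \<theta>)" using param by (simp add: parameter_function_def)
  then have isc: "isCont (deriv \<theta>) u" if "0 < u" for u
    using that by (simp add: continuous_on_eq_continuous_at)
  have "\<exists>F. \<forall>u. ereal 0 < ereal u \<longrightarrow> ereal u < \<infinity> \<longrightarrow> (F has_vector_derivative (deriv \<theta> u)\<^sup>2) (at u)"
    by (rule einterval_antiderivative) (auto intro!: continuous_intros isc)
  then obtain F where F: "\<And>u. 0 < u \<Longrightarrow> (F has_real_derivative (deriv \<theta> u)\<^sup>2) (at u)"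
    by (auto simp: has_real_derivative_iff_has_vector_derivative)
  define g where "g = (\<lambda>s. indicator {0<..} s * (deriv \<theta> s)\<^sup>2)"
  have "(\<lambda>s. indicator {0<..} s *\<^sub>R (deriv \<theta> s)\<^sup>2) \<in> borel_measurable borel"
    by (rule borel_measurable_continuous_on_indicator) (auto intro!: continuous_intros cont)
  then have g: "g \<in> borel_measurable borel" by (simp add: g_def)
  have int: "(\<integral>\<^sup>+ s\<in>{a<..b}. ennreal ((deriv \<theta> s)\<^sup>2) \<partial>lborel) = ennreal (F b - F a)"
    if "0 < a" "a \<le> b" for a b
  proof -
    have "(\<integral>\<^sup>+ s\<in>{a<..b}. ennreal ((deriv \<theta> s)\<^sup>2) \<partial>lborel) = (\<integral>\<^sup>+ s. ennreal (g s) * indicator {a..b} s \<partial>lborel)"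
    proof (rule nn_integral_cong_AE)
      have "AE s in lborel. s \<noteq> a" by (rule AE_lborel_singleton)
      then show "AE s in lborel. ennreal ((deriv \<theta> s)\<^sup>2) * indicator {a<..b} s = ennreal (g s) * indicator {a..b} s"
        by eventually_elim (use that in \<open>auto simp: g_def indicator_def\<close>)
    qed
    also have "\<dots> = ennreal (F b - F a)"
      by (rule nn_integral_FTC_Icc[OF g]) (use that F in \<open>auto simp: g_def\<close>)
    finally show ?thesis .
  qed
  have Fmono: "F a \<le> F b" if "0 < a" "a \<le> b" for a b
    by (rule DERIV_nonneg_imp_nondecreasing[OF that(2)]) (meson F that(1) less_le_trans zero_le_power2)
  define G where "G = (\<lambda>u. F u - F 1)"
  show ?thesis
  proof (rule that[of G])
    show "(G has_real_derivative (deriv \<theta> u)\<^sup>2) (at u)" if "0 < u" for u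
      unfolding G_def using F[OF that] by (auto intro!: derivative_eq_intros)
    show "eta \<theta> u = ereal (G u)" if "0 < u" for u
    proof (cases "1 \<le> u")
      case True
      then show ?thesis using int[of 1 u] Fmono[of 1 u] by (simp add: eta_def G_def enn2ereal_ennreal)
    next
      case False
      then show ?thesis using int[of u 1] Fmono[of u 1] that by (simp add: eta_def G_def enn2ereal_ennreal)
    qed
  qed
qed

section \<open>Confinement and dissipation\<close>

text \<open>A curve of maximal slope issuing from a point that satisfies Condition (A).  The starting point
  \<open>x\<^sub>0\<close> equals \<open>y\<^sub>0\<close> (lemma \<open>y_0\<close>), so \<open>f\<close> is finite there because it is finite along the
  curve.\<close>
locale condition_A_curve =
  fixes f :: "'a::complete_space \<Rightarrow> ereal"
    and x0 :: 'a and r :: real and \<theta> :: "real \<Rightarrow> real"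
    and T :: ereal and y :: "real \<Rightarrow> 'a"
  assumes f_nonneg: "\<And>x. 0 \<le> f x"
    and lsc: "lower_semicont f"
    and r_pos: "0 < r"
    and param: "parameter_function \<theta>"
    and cond_A: "condition_A f \<theta> x0 r"
    and T_pos: "0 < T"
    and curve: "max_slope_curve f (times_below T) y"
    and start: "starts_at (times_below T) y x0"
begin

text \<open>The energy along the curve.\<close>
definition h :: "real \<Rightarrow> real" where "h t = real_of_ereal (f (y t))"

lemma times_below_down: "t \<in> times_below T \<Longrightarrow> 0 \<le> s \<Longrightarrow> s \<le> t \<Longrightarrow> s \<in> times_below T"
  by (auto simp: times_below_def intro: le_less_trans[OF ereal_less_eq(3)[THEN iffD2]])

lemma zero_in: "0 \<in> times_below T"
  using T_pos by (simp add: times_below_def zero_ereal_def)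

lemma f_finite: "t \<in> times_below T \<Longrightarrow> \<bar>f (y t)\<bar> \<noteq> \<infinity>"
  using curve by (auto simp: max_slope_curve_def)

lemma f_eq_h: "t \<in> times_below T \<Longrightarrow> f (y t) = ereal (h t)"
  using f_finite by (simp add: h_def ereal_real)

lemma h_nonneg: "0 \<le> h t"
  using f_nonneg by (simp add: h_def real_of_ereal_pos)

lemma control:
  assumes "b \<in> times_below T"
  obtains M where "integrable lborel M" "\<And>x. 0 \<le> M x"
    "\<And>s t. 0 \<le> s \<Longrightarrow> s \<le> t \<Longrightarrow> t \<le> b \<Longrightarrow> dist (y t) (y s) \<le> cumul M t - cumul M s"
    "\<And>s t. 0 \<le> s \<Longrightarrow> s \<le> t \<Longrightarrow> t \<le> b \<Longrightarrow> \<bar>h t - h s\<bar> \<le> cumul M t - cumul M s"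
    "AE t in lborel. 0 < t \<and> t < b \<longrightarrow> (\<exists>v D. has_speed y v t \<and> (h has_real_derivative D) (at t) \<and>
       ereal (1/2 * v\<^sup>2) + ereal (1/2) * (slope f (y t))\<^sup>2 \<le> ereal (- D))"
proof -
  have h: "(\<lambda>s. real_of_ereal (f (y s))) = h" by (auto simp: h_def)
  show ?thesis
    using max_slope_curve_control[OF curve assms] that unfolding h h_def[symmetric] by blast
qed

lemma continuous_y: "b \<in> times_below T \<Longrightarrow> continuous_on {0..b} y"
  and continuous_h: "b \<in> times_below T \<Longrightarrow> continuous_on {0..b} h"
proof -
  assume "b \<in> times_below T"
  then obtain M where M: "integrable lborel M"
    "\<And>s t. 0 \<le> s \<Longrightarrow> s \<le> t \<Longrightarrow> t \<le> b \<Longrightarrow> dist (y t) (y s) \<le> cumul M t - cumul M s"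
    "\<And>s t. 0 \<le> s \<Longrightarrow> s \<le> t \<Longrightarrow> t \<le> b \<Longrightarrow> \<bar>h t - h s\<bar> \<le> cumul M t - cumul M s"
    by (elim control) blast
  show "continuous_on {0..b} y"
    by (rule continuous_on_of_cumul_bound[OF M(1)]) (use M(2) in auto)
  show "continuous_on {0..b} h"
    by (rule continuous_on_of_cumul_bound[OF M(1)]) (use M(3) in \<open>auto simp: dist_real_def\<close>)
qed

lemma y_0: "y 0 = x0"
proof -
  obtain b where b: "0 < ereal b" "ereal b < T" using ereal_dense2[OF T_pos] by blast
  then have bJ: "b \<in> times_below T" "0 < b" by (auto simp: times_below_def zero_ereal_def)
  have "(INF t\<in>times_below T. ereal t) = 0"
    by (rule INF_eqI) (use zero_in in \<open>auto simp: times_below_def zero_ereal_def\<close>)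
  then have "((\<lambda>t. y (real_of_ereal t)) \<longlongrightarrow> x0) (at_right (ereal 0))"
    using start by (simp add: starts_at_def zero_ereal_def)
  moreover have "filterlim ereal (at_right (ereal 0)) (at_right 0)"
    unfolding filterlim_at by (auto intro!: tendsto_intros simp: eventually_at_filter)
  ultimately have "(y \<longlongrightarrow> x0) (at_right 0)"
    using filterlim_compose[of "\<lambda>t. y (real_of_ereal t)" "nhds x0" "at_right (ereal 0)" ereal "at_right 0"] by simp
  moreover have "(y \<longlongrightarrow> y 0) (at_right 0)"
    using continuous_y[OF bJ(1)] bJ(2) by (auto simp: continuous_on_def at_within_Icc_at_right dest!: bspec[of _ _ 0])
  ultimately show ?thesis using tendsto_unique trivial_limit_at_right_real by blast
qed

lemma h_0: "h 0 = real_of_ereal (f x0)" "f x0 = ereal (h 0)" "\<theta> (h 0) \<le> r"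
  using f_eq_h[OF zero_in] cond_A by (auto simp: h_def y_0 condition_A_def)

lemma h_antimono:
  assumes "0 \<le> s" "s \<le> t" "t \<in> times_below T"
  shows "h t \<le> h s"
proof -
  obtain M where M: "integrable lborel M" "\<And>x. 0 \<le> M x"
    "\<And>u w. 0 \<le> u \<Longrightarrow> u \<le> w \<Longrightarrow> w \<le> t \<Longrightarrow> dist (y w) (y u) \<le> cumul M w - cumul M u"
    "\<And>u w. 0 \<le> u \<Longrightarrow> u \<le> w \<Longrightarrow> w \<le> t \<Longrightarrow> \<bar>h w - h u\<bar> \<le> cumul M w - cumul M u"
    "AE u in lborel. 0 < u \<and> u < t \<longrightarrow> (\<exists>v D. has_speed y v u \<and> (h has_real_derivative D) (at u) \<and>
       ereal (1/2 * v\<^sup>2) + ereal (1/2) * (slope f (y u))\<^sup>2 \<le> ereal (- D))"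
    using control[OF assms(3)] by blast
  have "(\<lambda>x. x) (h t) + 0 * dist (y t) (y s) \<le> (\<lambda>x. x) (h s) + 0 * (t - s)"
  proof (rule rate_inequality[where L=1 and M=M and h=h])
    show "AE u in lborel. s < u \<and> u < t \<longrightarrow> (\<exists>v D p. has_speed y v u \<and> (h has_real_derivative D) (at u) \<and>
        ((\<lambda>x. x) has_real_derivative p) (at (h u)) \<and> p * D + 0 * v \<le> 0)"
      using M(5)
    proof (eventually_elim, intro impI)
      fix u assume "0 < u \<and> u < t \<longrightarrow> (\<exists>v D. has_speed y v u \<and> (h has_real_derivative D) (at u) \<and>
       ereal (1/2 * v\<^sup>2) + ereal (1/2) * (slope f (y u))\<^sup>2 \<le> ereal (- D))" "s < u \<and> u < t"
      then obtain v D where vD: "has_speed y v u" "(h has_real_derivative D) (at u)"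
        "ereal (1/2 * v\<^sup>2) + ereal (1/2) * (slope f (y u))\<^sup>2 \<le> ereal (- D)" using assms by auto
      have "D \<le> 0" using dissipation_ineqD[OF vD(3)] zero_le_power2[of v] by linarith
      then show "\<exists>v D p. has_speed y v u \<and> (h has_real_derivative D) (at u) \<and>
        ((\<lambda>x. x) has_real_derivative p) (at (h u)) \<and> p * D + 0 * v \<le> 0"
        using vD by (intro exI[of _ v] exI[of _ D] exI[of _ 1]) auto
    qed
  qed (use assms M in auto)
  then show ?thesis by simp
qed

lemma y_constant:
  assumes "0 \<le> s" "s \<le> t" "t \<in> times_below T" "h s = 0"
  shows "y t = y s"
proof -
  obtain M where M: "integrable lborel M" "\<And>x. 0 \<le> M x"
    "\<And>u w. 0 \<le> u \<Longrightarrow> u \<le> w \<Longrightarrow> w \<le> t \<Longrightarrow> dist (y w) (y u) \<le> cumul M w - cumul M u"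
    "\<And>u w. 0 \<le> u \<Longrightarrow> u \<le> w \<Longrightarrow> w \<le> t \<Longrightarrow> \<bar>h w - h u\<bar> \<le> cumul M w - cumul M u"
    "AE u in lborel. 0 < u \<and> u < t \<longrightarrow> (\<exists>v D. has_speed y v u \<and> (h has_real_derivative D) (at u) \<and>
       ereal (1/2 * v\<^sup>2) + ereal (1/2) * (slope f (y u))\<^sup>2 \<le> ereal (- D))"
    using control[OF assms(3)] by blast
  have h0: "h u = 0" if "s \<le> u" "u \<le> t" for u
    using h_antimono[of s u] h_nonneg[of u] assms that times_below_down[OF assms(3), of u] by auto
  have "(\<lambda>x. 0) (h t) + 1 * dist (y t) (y s) \<le> (\<lambda>x. 0) (h s) + 0 * (t - s)"
  proof (rule rate_inequality[where L=0 and M=M and h=h])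
    show "AE u in lborel. s < u \<and> u < t \<longrightarrow> (\<exists>v D p. has_speed y v u \<and> (h has_real_derivative D) (at u) \<and>
        ((\<lambda>x. 0) has_real_derivative p) (at (h u)) \<and> p * D + 1 * v \<le> 0)"
      using M(5)
    proof (eventually_elim, intro impI)
      fix u assume "0 < u \<and> u < t \<longrightarrow> (\<exists>v D. has_speed y v u \<and> (h has_real_derivative D) (at u) \<and>
       ereal (1/2 * v\<^sup>2) + ereal (1/2) * (slope f (y u))\<^sup>2 \<le> ereal (- D))" and u: "s < u \<and> u < t"
      then obtain v D where vD: "has_speed y v u" "(h has_real_derivative D) (at u)"
        "ereal (1/2 * v\<^sup>2) + ereal (1/2) * (slope f (y u))\<^sup>2 \<le> ereal (- D)" using assms by auto
      \<comment> \<open>The energy vanishes identically near \<open>u\<close>, which forces zero speed.\<close>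
      have "(h has_real_derivative 0) (at u)"
        by (rule has_field_derivative_transform_within_open[OF DERIV_const[of 0], of "{s<..<t}"])
          (use u h0 in auto)
      then have "D = 0" using vD(2) DERIV_unique by blast
      then have "v\<^sup>2 \<le> 0" using dissipation_ineqD[OF vD(3)] by simp
      then have "v = 0" by simp
      then show "\<exists>v D p. has_speed y v u \<and> (h has_real_derivative D) (at u) \<and>
        ((\<lambda>x. 0) has_real_derivative p) (at (h u)) \<and> p * D + 1 * v \<le> 0"
        using vD by (intro exI[of _ v] exI[of _ D] exI[of _ 0]) auto
    qed
  qed (use assms M in auto)
  then show ?thesis by simp
qed

text \<open>Inside the ball and at positive energy, Condition (A) applies at almost every time.  In the second
  part \<open>G\<close> is any primitive of \<open>\<theta>'\<^sup>2\<close>.\<close>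
lemma dissipation_in_ball:
  assumes ab: "0 \<le> a" "a \<le> b" and b: "b \<in> times_below T" and pos: "0 < h b"
    and ball: "\<And>t. a < t \<Longrightarrow> t < b \<Longrightarrow> y t \<in> ball x0 r"
  shows "\<theta> (h b) + dist (y b) (y a) \<le> \<theta> (h a)"
    and "\<And>G. (\<And>u. 0 < u \<Longrightarrow> (G has_real_derivative (deriv \<theta> u)\<^sup>2) (at u)) \<Longrightarrow> G (h b) \<le> G (h a) - (b - a)"
proof -
  obtain M where M: "integrable lborel M" "\<And>x. 0 \<le> M x"
    "\<And>u w. 0 \<le> u \<Longrightarrow> u \<le> w \<Longrightarrow> w \<le> b \<Longrightarrow> dist (y w) (y u) \<le> cumul M w - cumul M u"
    "\<And>u w. 0 \<le> u \<Longrightarrow> u \<le> w \<Longrightarrow> w \<le> b \<Longrightarrow> \<bar>h w - h u\<bar> \<le> cumul M w - cumul M u"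
    "AE u in lborel. 0 < u \<and> u < b \<longrightarrow> (\<exists>v D. has_speed y v u \<and> (h has_real_derivative D) (at u) \<and>
       ereal (1/2 * v\<^sup>2) + ereal (1/2) * (slope f (y u))\<^sup>2 \<le> ereal (- D))"
    using control[OF b] by blast
  have range: "h u \<in> {h b..h a}" if "u \<in> {a..b}" for u
    using that h_antimono[of u b] h_antimono[of a u] ab b times_below_down[OF b, of u] by auto
  have key: "AE u in lborel. a < u \<and> u < b \<longrightarrow> (\<exists>v D. has_speed y v u \<and> (h has_real_derivative D) (at u) \<and>
      0 < h u \<and> deriv \<theta> (h u) * D + v \<le> 0 \<and> (deriv \<theta> (h u))\<^sup>2 * D \<le> - 1)"
    using M(5)
  proof (eventually_elim, intro impI)
    fix u assume "0 < u \<and> u < b \<longrightarrow> (\<exists>v D. has_speed y v u \<and> (h has_real_derivative D) (at u) \<and>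
       ereal (1/2 * v\<^sup>2) + ereal (1/2) * (slope f (y u))\<^sup>2 \<le> ereal (- D))" and u: "a < u \<and> u < b"
    then obtain v D where vD: "has_speed y v u" "(h has_real_derivative D) (at u)"
        "ereal (1/2 * v\<^sup>2) + ereal (1/2) * (slope f (y u))\<^sup>2 \<le> ereal (- D)" using ab by auto
    have uJ: "u \<in> times_below T" using times_below_down[OF b, of u] u ab by auto
    have hu: "0 < h u" using range[of u] u pos by auto
    have "h u \<le> h 0" using h_antimono[of 0 u] u ab uJ by auto
    then have "0 < f (y u) \<and> f (y u) \<le> f x0"
      using hu f_eq_h[OF uJ] h_0(2) by (simp add: zero_ereal_def)
    then have cA: "1 \<le> ereal (deriv \<theta> (h u)) * slope f (y u)"
      using cond_A ball[of u] u unfolding condition_A_def h_def by blast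
    have "\<forall>\<^sub>F s in at u. s \<in> {a<..<b}" using u by (intro eventually_at_in_open') auto
    then have ev: "\<forall>\<^sub>F s in at u. \<bar>f (y s)\<bar> \<noteq> \<infinity>"
      by eventually_elim (use f_finite times_below_down[OF b] ab in auto)
    have h_eta: "(\<lambda>s. real_of_ereal (f (y s))) = h" by (auto simp: h_def)
    note * = dissipation_pointwise[OF vD(1) _ ev f_finite[OF uJ] vD(3) parameter_function_DERIV(2)[OF param hu] cA,
        unfolded h_eta, OF vD(2)]
    show "\<exists>v D. has_speed y v u \<and> (h has_real_derivative D) (at u) \<and>
      0 < h u \<and> deriv \<theta> (h u) * D + v \<le> 0 \<and> (deriv \<theta> (h u))\<^sup>2 * D \<le> - 1"
      using vD(1,2) hu * by blast
  qed
  have cont: "continuous_on {h b..h a} (deriv \<theta>)"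
    using param pos unfolding parameter_function_def by (auto elim!: continuous_on_subset)
  obtain L where L: "0 \<le> L" "\<And>u w. u \<in> {h b..h a} \<Longrightarrow> w \<in> {h b..h a} \<Longrightarrow> \<bar>\<theta> u - \<theta> w\<bar> \<le> L * \<bar>u - w\<bar>"
    by (rule C1_lipschitz[OF _ cont, of \<theta>]) (use parameter_function_DERIV(1)[OF param] pos in auto)
  have "\<theta> (h b) + 1 * dist (y b) (y a) \<le> \<theta> (h a) + 0 * (b - a)"
  proof (rule rate_inequality[where L=L and M=M and h=h])
    show "AE u in lborel. a < u \<and> u < b \<longrightarrow> (\<exists>v D p. has_speed y v u \<and> (h has_real_derivative D) (at u) \<and>
        (\<theta> has_real_derivative p) (at (h u)) \<and> p * D + 1 * v \<le> 0)"
      using key by eventually_elim (use parameter_function_DERIV(1)[OF param] in force)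
    show "\<bar>\<theta> (h t) - \<theta> (h s)\<bar> \<le> L * \<bar>h t - h s\<bar>" if "s \<in> {a..b}" "t \<in> {a..b}" for s t
      using range that by (intro L(2)) auto
  qed (use ab M L in auto)
  then show "\<theta> (h b) + dist (y b) (y a) \<le> \<theta> (h a)" by simp
  fix G assume G: "\<And>u. 0 < u \<Longrightarrow> (G has_real_derivative (deriv \<theta> u)\<^sup>2) (at u)"
  have cont2: "continuous_on {h b..h a} (\<lambda>u. (deriv \<theta> u)\<^sup>2)" using cont by (intro continuous_intros)
  obtain K where K: "0 \<le> K" "\<And>u w. u \<in> {h b..h a} \<Longrightarrow> w \<in> {h b..h a} \<Longrightarrow> \<bar>G u - G w\<bar> \<le> K * \<bar>u - w\<bar>"
    by (rule C1_lipschitz[OF _ cont2, of G]) (use G pos in auto)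
  have "G (h b) + 0 * dist (y b) (y a) \<le> G (h a) + (- 1) * (b - a)"
  proof (rule rate_inequality[where L=K and M=M and h=h])
    show "AE u in lborel. a < u \<and> u < b \<longrightarrow> (\<exists>v D p. has_speed y v u \<and> (h has_real_derivative D) (at u) \<and>
        (G has_real_derivative p) (at (h u)) \<and> p * D + 0 * v \<le> - 1)"
      using key by eventually_elim (use G in force)
    show "\<bar>G (h t) - G (h s)\<bar> \<le> K * \<bar>h t - h s\<bar>" if "s \<in> {a..b}" "t \<in> {a..b}" for s t
      using range that by (intro K(2)) auto
  qed (use ab M K in auto)
  then show "G (h b) \<le> G (h a) - (b - a)" by simp
qed

lemma h_pos_before: "b \<in> times_below T \<Longrightarrow> 0 < h b \<Longrightarrow> 0 \<le> t \<Longrightarrow> t \<le> b \<Longrightarrow> 0 < h t"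
  using h_antimono[of t b] by simp

lemma theta_pos: "0 < u \<Longrightarrow> 0 < \<theta> u" and theta_nonneg: "0 \<le> u \<Longrightarrow> 0 \<le> \<theta> u" and theta_0: "\<theta> 0 = 0"
proof -
  show 0: "\<theta> 0 = 0" using param by (simp add: parameter_function_def)
  show "0 < u \<Longrightarrow> 0 < \<theta> u" "0 \<le> u \<Longrightarrow> 0 \<le> \<theta> u"
    using parameter_function_strict_mono[OF param, of 0 u] parameter_function_mono[OF param, of 0 u] 0 by auto
qed

text \<open>First exit time argument: at the first time \<open>\<tau>\<close> outside the ball, the dissipation inequality on
  \<open>[0,\<tau>]\<close> gives \<open>d(y\<^sub>\<tau>, x\<^sub>0) \<le> r - \<theta>(h(\<tau>)) < r\<close>.\<close>
lemma confined:
  assumes b: "b \<in> times_below T" and pos: "0 < h b" and t: "0 \<le> t" "t \<le> b"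
  shows "y t \<in> ball x0 r"
proof (rule ccontr)
  assume "y t \<notin> ball x0 r"
  define S where "S = {0..b} \<inter> y -` (- ball x0 r)"
  have "closed S" unfolding S_def
    by (rule continuous_closed_preimage[OF continuous_y[OF b]]) auto
  moreover have "S \<noteq> {}" using t \<open>y t \<notin> ball x0 r\<close> by (auto simp: S_def)
  moreover have bdd: "bdd_below S" by (auto simp: S_def bdd_below_def)
  ultimately have IS: "Inf S \<in> S" by (intro closed_contains_Inf)
  define \<tau> where "\<tau> = Inf S"
  have \<tau>: "0 \<le> \<tau>" "\<tau> \<le> b" "y \<tau> \<notin> ball x0 r" using IS by (auto simp: S_def \<tau>_def)
  have before: "y u \<in> ball x0 r" if "0 \<le> u" "u < \<tau>" for u
    using cInf_lower[OF _ bdd, of u] that \<tau> unfolding \<tau>_def[symmetric] by (force simp: S_def)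
  have \<tau>J: "\<tau> \<in> times_below T" using times_below_down[OF b] \<tau> by auto
  have h\<tau>: "0 < h \<tau>" using h_pos_before[OF b pos] \<tau> by auto
  have "\<theta> (h \<tau>) + dist (y \<tau>) (y 0) \<le> \<theta> (h 0)"
    by (rule dissipation_in_ball(1)) (use \<tau> \<tau>J h\<tau> before in auto)
  then have "dist (y \<tau>) x0 < r" using theta_pos[OF h\<tau>] h_0(3) by (simp add: y_0)
  then show False using \<tau>(3) by (simp add: dist_commute)
qed

lemma first_zero:
  assumes t: "t \<in> times_below T" and "h t = 0"
  obtains \<tau> where "0 \<le> \<tau>" "\<tau> \<le> t" "h \<tau> = 0" "y t = y \<tau>" "\<And>u. 0 \<le> u \<Longrightarrow> u < \<tau> \<Longrightarrow> 0 < h u"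
proof -
  have t0: "0 \<le> t" using t by (simp add: times_below_def)
  define S where "S = {0..t} \<inter> h -` {0}"
  have "closed S" unfolding S_def
    by (rule continuous_closed_preimage[OF continuous_h[OF t]]) auto
  moreover have "S \<noteq> {}" using t0 assms(2) by (auto simp: S_def)
  moreover have bdd: "bdd_below S" by (auto simp: S_def bdd_below_def)
  ultimately have IS: "Inf S \<in> S" by (intro closed_contains_Inf)
  define \<tau> where "\<tau> = Inf S"
  have \<tau>: "0 \<le> \<tau>" "\<tau> \<le> t" "h \<tau> = 0" using IS by (auto simp: S_def \<tau>_def)
  have "h u \<noteq> 0" if "0 \<le> u" "u < \<tau>" for u
    using cInf_lower[OF _ bdd, of u] that \<tau> unfolding \<tau>_def[symmetric] by (force simp: S_def)
  then have "0 < h u" if "0 \<le> u" "u < \<tau>" for u using that h_nonneg[of u] by (metis less_le)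
  moreover have "y t = y \<tau>" by (rule y_constant) (use \<tau> t in auto)
  ultimately show ?thesis using that \<tau> by blast
qed

lemma limit_in_closed:
  assumes "0 \<le> s" "s < \<tau>" "\<tau> \<in> times_below T" "closed C" "\<And>u. s \<le> u \<Longrightarrow> u < \<tau> \<Longrightarrow> y u \<in> C"
  shows "y \<tau> \<in> C"
proof -
  have cl: "closure {s..<\<tau>} = {s..\<tau>}" using assms by simp
  have "continuous_on (closure {s..<\<tau>}) y"
    unfolding cl by (rule continuous_on_subset[OF continuous_y[OF assms(3)]]) (use assms in auto)
  then have "y ` closure {s..<\<tau>} \<subseteq> C"
    by (rule image_closure_subset) (use assms in auto)
  then show ?thesis unfolding cl using assms by auto
qed

text \<open>The closure of the ball may be smaller than the closed ball, so at zero energy the point is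
  obtained as a limit of points of the curve at positive energy.\<close>
lemma in_closure_ball:
  assumes "t \<in> times_below T" shows "y t \<in> closure (ball x0 r)"
proof (cases "0 < h t")
  case True
  then have "y t \<in> ball x0 r" using confined[of t t] assms by (auto simp: times_below_def)
  then show ?thesis using closure_subset by blast
next
  case False
  then have "h t = 0" using h_nonneg[of t] by simp
  from first_zero[OF assms this] obtain \<tau> where \<tau>: "0 \<le> \<tau>" "\<tau> \<le> t" "h \<tau> = 0" "y t = y \<tau>"
    "\<And>u. 0 \<le> u \<Longrightarrow> u < \<tau> \<Longrightarrow> 0 < h u" by blast
  have \<tau>J: "\<tau> \<in> times_below T" using \<tau> assms times_below_down by blast
  have "y \<tau> \<in> closure (ball x0 r)"
  proof (cases "\<tau> = 0")
    case True
    then show ?thesis using r_pos closure_subset[of "ball x0 r"] by (auto simp: y_0)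
  next
    case False
    show ?thesis
    proof (rule limit_in_closed[of 0])
      fix u assume "0 \<le> u" "u < \<tau>"
      then have "y u \<in> ball x0 r" using confined[of u u] \<tau> times_below_down[OF \<tau>J] by auto
      then show "y u \<in> closure (ball x0 r)" using closure_subset by blast
    qed (use \<tau> \<tau>J False in auto)
  qed
  then show ?thesis using \<tau> by simp
qed

lemma dissipation:
  assumes st: "0 \<le> s" "s \<le> t" and t: "t \<in> times_below T"
  shows "\<theta> (h t) + dist (y t) (y s) \<le> \<theta> (h s)"
proof (cases "0 < h t")
  case True
  show ?thesis
    by (rule dissipation_in_ball(1)) (use assms True confined[OF t True] in auto)
next
  case False
  then have ht: "h t = 0" using h_nonneg[of t] by simp
  from first_zero[OF t this] obtain \<tau> where \<tau>: "0 \<le> \<tau>" "\<tau> \<le> t" "h \<tau> = 0" "y t = y \<tau>"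
    "\<And>u. 0 \<le> u \<Longrightarrow> u < \<tau> \<Longrightarrow> 0 < h u" by blast
  have \<tau>J: "\<tau> \<in> times_below T" using \<tau> t times_below_down by blast
  have "dist (y t) (y s) \<le> \<theta> (h s)"
  proof (cases "s < \<tau>")
    case True
    have "y \<tau> \<in> cball (y s) (\<theta> (h s))"
    proof (rule limit_in_closed[OF st(1) True \<tau>J])
      fix u assume u: "s \<le> u" "u < \<tau>"
      then have uJ: "u \<in> times_below T" "0 < h u" using \<tau> st times_below_down[OF \<tau>J] by auto
      have "\<theta> (h u) + dist (y u) (y s) \<le> \<theta> (h s)"
        by (rule dissipation_in_ball(1)) (use st u uJ confined[OF uJ] in auto)
      then show "y u \<in> cball (y s) (\<theta> (h s))" using theta_pos[OF uJ(2)] by (simp add: dist_commute)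
    qed simp
    then show ?thesis using \<tau>(4) by (simp add: dist_commute)
  next
    case False
    then have "y s = y \<tau>" using y_constant[of \<tau> s] \<tau> times_below_down[OF t] st by auto
    then show ?thesis using \<tau>(4) theta_nonneg[OF h_nonneg] by simp
  qed
  then show ?thesis by (simp add: ht theta_0)
qed

lemma energy_rate:
  assumes "t \<in> times_below T" "0 < h t"
    and "\<And>u. 0 < u \<Longrightarrow> (G has_real_derivative (deriv \<theta> u)\<^sup>2) (at u)"
  shows "G (h t) \<le> G (h 0) - t"
  using dissipation_in_ball(2)[of 0 t G] assms confined[OF assms(1,2)] by (auto simp: times_below_def)

section \<open>The endpoint and convergence rates\<close>

lemma eventually_below_T:
  assumes "s \<in> times_below T"
  shows "\<forall>\<^sub>F u in at_left T. real_of_ereal u \<in> times_below T \<and> s \<le> real_of_ereal u"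
proof -
  have s: "0 \<le> s" "ereal s < T" using assms by (auto simp: times_below_def)
  have "\<forall>\<^sub>F u in at_left T. ereal s < u \<and> u < T"
    using s by (auto simp: eventually_at_left[OF s(2)])
  then show ?thesis
  proof eventually_elim
    case (elim u)
    then obtain x where "u = ereal x" by (cases u) auto
    then show ?case using elim s by (auto simp: times_below_def)
  qed
qed

lemma at_left_T_neq_bot: "at_left T \<noteq> bot"
proof -
  have "\<not> (\<forall>\<^sub>F u in at_left T. False)"
    unfolding eventually_at_left[OF T_pos] using dense by blast
  then show ?thesis by (simp add: trivial_limit_def)
qed

text \<open>The nonincreasing function \<open>\<theta> \<circ> h\<close> has the infimum \<open>i \<ge> 0\<close> as its limit, and it dominates the
  increments of the curve.\<close>
lemma endpoint_exists: "\<exists>yT. ((\<lambda>t. y (real_of_ereal t)) \<longlongrightarrow> yT) (at_left T)"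
proof -
  define F where "F = filtermap (\<lambda>t. y (real_of_ereal t)) (at_left T)"
  define i where "i = (INF t\<in>times_below T. \<theta> (h t))"
  have bdd: "bdd_below ((\<lambda>t. \<theta> (h t)) ` times_below T)"
    using theta_nonneg[OF h_nonneg] by (auto simp: bdd_below_def)
  \<comment> \<open>\<open>s\<close> is chosen so that the dissipation after time \<open>s\<close> is less than \<open>e\<close>.\<close>
  have "cauchy_filter F"
    unfolding F_def cauchy_filter_metric_filtermap
  proof (intro allI impI)
    fix e :: real assume "e > 0"
    then have "i < i + e" by simp
    then obtain s where s: "s \<in> times_below T" "\<theta> (h s) < i + e"
      unfolding i_def using zero_in by (subst (asm) cINF_less_iff[OF _ bdd]) auto
    have close: "dist (y v) (y u) < e" if "s \<le> u" "u \<le> v" "v \<in> times_below T" for u v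
    proof -
      have s0: "0 \<le> s" using s by (simp add: times_below_def)
      have uJ: "u \<in> times_below T" using times_below_down[OF that(3)] that s0 by auto
      have "i \<le> \<theta> (h v)" unfolding i_def by (rule cINF_lower[OF bdd that(3)])
      moreover have "\<theta> (h v) + dist (y v) (y u) \<le> \<theta> (h u)"
        using s0 that by (intro dissipation) auto
      moreover have "\<theta> (h u) + dist (y u) (y s) \<le> \<theta> (h s)"
        using s0 that uJ by (intro dissipation) auto
      ultimately show ?thesis using s(2) zero_le_dist[of "y u" "y s"] by linarith
    qed
    have "dist (y u) (y v) < e" if "u \<in> times_below T" "v \<in> times_below T" "s \<le> u" "s \<le> v" for u v
      using close[of u v] close[of v u] that by (cases "u \<le> v") (auto simp: dist_commute)
    then show "\<exists>P. eventually P (at_left T) \<and> (\<forall>x z. P x \<and> P z \<longrightarrow>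
        dist (y (real_of_ereal x)) (y (real_of_ereal z)) < e)"
      using eventually_below_T[OF s(1)] by blast
  qed
  moreover have "F \<noteq> bot" using at_left_T_neq_bot by (simp add: F_def filtermap_bot_iff)
  ultimately have "\<exists>c. F \<le> nhds c"
    using complete_UNIV unfolding complete_uniform by auto
  then show ?thesis by (simp add: F_def filterlim_def)
qed

text \<open>Lower semicontinuity is stated with the punctured neighbourhood filter, but a strict lower bound
  that also holds at \<open>yT\<close> itself holds on a full neighbourhood, so it does not matter if the curve
  takes the value \<open>yT\<close> before time \<open>T\<close>.\<close>
lemma f_endpoint_le:
  assumes yT: "((\<lambda>t. y (real_of_ereal t)) \<longlongrightarrow> yT) (at_left T)" and t: "t \<in> times_below T"
  shows "f yT \<le> f (y t)"
proof (rule ccontr)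
  assume "\<not> f yT \<le> f (y t)"
  then have less: "f (y t) < f yT" by simp
  also have "f yT \<le> Liminf (at yT) f" using lsc by (simp add: lower_semicont_def)
  finally have "\<forall>\<^sub>F z in at yT. f (y t) < f z" by (rule less_LiminfD)
  then have "\<forall>\<^sub>F z in nhds yT. f (y t) < f z" using less by (simp add: eventually_nhds_conv_at)
  then have "\<forall>\<^sub>F u in at_left T. f (y t) < f (y (real_of_ereal u))"
    by (rule eventually_compose_filterlim[OF _ yT])
  with eventually_below_T[OF t] have "\<forall>\<^sub>F u in at_left T. False"
  proof eventually_elim
    case (elim u)
    have "h (real_of_ereal u) \<le> h t" using h_antimono elim t by (auto simp: times_below_def)
    then show ?case using elim f_eq_h[OF t] f_eq_h[of "real_of_ereal u"] by simp
  qed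
  then show False using at_left_T_neq_bot by (simp add: trivial_limit_def)
qed

lemma dissipation_endpoint:
  assumes yT: "((\<lambda>t. y (real_of_ereal t)) \<longlongrightarrow> yT) (at_left T)" and s: "s \<in> times_below T"
  shows "\<theta> (real_of_ereal (f yT)) + dist yT (y s) \<le> \<theta> (h s)"
proof -
  have fT: "0 \<le> real_of_ereal (f yT)" using f_nonneg by (simp add: real_of_ereal_pos)
  have "dist yT (y s) \<le> \<theta> (h s) - \<theta> (real_of_ereal (f yT))"
  proof (rule tendsto_upperbound[OF tendsto_dist[OF yT tendsto_const] _ at_left_T_neq_bot])
    show "\<forall>\<^sub>F u in at_left T. dist (y (real_of_ereal u)) (y s) \<le> \<theta> (h s) - \<theta> (real_of_ereal (f yT))"
      using eventually_below_T[OF s]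
    proof eventually_elim
      case (elim u)
      let ?u = "real_of_ereal u"
      have "f yT \<le> ereal (h ?u)" using f_endpoint_le[OF yT, of ?u] f_eq_h[of ?u] elim by simp
      then have "real_of_ereal (f yT) \<le> h ?u"
        using f_nonneg[of yT] by (cases "f yT") auto
      then have "\<theta> (real_of_ereal (f yT)) \<le> \<theta> (h ?u)" by (rule parameter_function_mono[OF param fT])
      moreover have "\<theta> (h ?u) + dist (y ?u) (y s) \<le> \<theta> (h s)"
        using elim s by (intro dissipation) (auto simp: times_below_def)
      ultimately show ?case by simp
    qed
  qed
  then show ?thesis by simp
qed

lemma h_pos_before_t_star:
  assumes "0 \<le> u" "ereal u < t_star f T y"
  shows "u \<in> times_below T" "0 < h u"
proof -
  show uJ: "u \<in> times_below T" using assms by (auto simp: t_star_def times_below_def)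
  have "f (y u) \<noteq> 0"
  proof
    assume "f (y u) = 0"
    then have "(INF t \<in> {t \<in> times_below T. f (y t) = 0}. ereal t) \<le> ereal u"
      using uJ by (intro INF_lower) auto
    then have "t_star f T y \<le> ereal u" by (simp add: t_star_def min.coboundedI1)
    then show False using assms by simp
  qed
  then show "0 < h u" using f_eq_h[OF uJ] h_nonneg[of u] by (auto simp: zero_ereal_def less_le)
qed

text \<open>At \<open>t = t\<^sub>*\<close> the energy may vanish and \<open>t\<close> may be infinite, so the bound is obtained by comparing
  with all earlier times, at which the energy is positive and at least that at time \<open>t\<close>.\<close>
lemma eta_rate:
  assumes yT: "((\<lambda>t. y (real_of_ereal t)) \<longlongrightarrow> yT) (at_left T)"
    and t: "0 \<le> t" "t \<le> t_star f T y"
  shows "eta \<theta> (real_of_ereal (f (extend_curve T y yT t))) \<le> eta \<theta> (h 0) - t"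
proof (cases "t = 0")
  case True
  then show ?thesis using T_pos by (simp add: extend_curve_def h_def)
next
  case False
  then have t0: "0 < t" using t by simp
  let ?A = "real_of_ereal (f (extend_curve T y yT t))"
  obtain G where G: "\<And>u. 0 < u \<Longrightarrow> (G has_real_derivative (deriv \<theta> u)\<^sup>2) (at u)"
    "\<And>u. 0 < u \<Longrightarrow> eta \<theta> u = ereal (G u)" using eta_antiderivative[OF param] by blast
  have "0 < h 0" using t0 t by (intro h_pos_before_t_star(2)) (auto simp: zero_ereal_def[symmetric])
  then have eta0: "eta \<theta> (h 0) = ereal (G (h 0))" by (rule G(2))
  show ?thesis unfolding eta0
  proof (rule ereal_le_diff_of_forall_less[OF t0])
    fix u assume u: "0 \<le> u" "ereal u < t"
    then have "ereal u < t_star f T y" using t by simp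
    note uJ = h_pos_before_t_star[OF u(1) this]
    have "?A \<le> h u"
    proof (cases "t < T")
      case True
      then obtain x where x: "t = ereal x" using t by (cases t) auto
      then have "x \<in> times_below T" using True t by (simp add: times_below_def)
      then show ?thesis using True x u h_antimono[of u x] by (simp add: extend_curve_def h_def)
    next
      case False
      have "f yT \<le> ereal (h u)" using f_endpoint_le[OF yT uJ(1)] f_eq_h[OF uJ(1)] by simp
      then have "real_of_ereal (f yT) \<le> h u" using f_nonneg[of yT] by (cases "f yT") auto
      then show ?thesis using False by (simp add: extend_curve_def)
    qed
    then have "eta \<theta> ?A \<le> eta \<theta> (h u)" by (rule eta_mono)
    also have "\<dots> = ereal (G (h u))" by (rule G(2)[OF uJ(2)])
    also have "\<dots> \<le> ereal (G (h 0) - u)" using energy_rate[OF uJ G(1)] by simp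
    finally show "eta \<theta> ?A \<le> ereal (G (h 0) - u)" .
  qed
qed

lemma dissipation_extended:
  assumes yT: "((\<lambda>t. y (real_of_ereal t)) \<longlongrightarrow> yT) (at_left T)" and st: "0 \<le> s" "s \<le> t" "t \<le> T"
  shows "dist (extend_curve T y yT t) (extend_curve T y yT s) \<le>
    \<theta> (real_of_ereal (f (extend_curve T y yT s))) - \<theta> (real_of_ereal (f (extend_curve T y yT t)))"
proof (cases "s < T")
  case True
  then obtain a where a: "s = ereal a" using st by (cases s) auto
  then have aJ: "a \<in> times_below T" using True st by (simp add: times_below_def)
  show ?thesis
  proof (cases "t < T")
    case t: True
    then obtain b where b: "t = ereal b" using st by (cases t) auto
    moreover have "0 \<le> t" using st by simp
    ultimately have "b \<in> times_below T" using t by (simp add: times_below_def)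
    then show ?thesis using dissipation[of a b] a b st True t by (simp add: extend_curve_def h_def)
  next
    case False
    then show ?thesis using dissipation_endpoint[OF yT aJ] True a by (simp add: extend_curve_def h_def)
  qed
next
  case False
  then have "\<not> t < T" using st by auto
  then show ?thesis using False by (simp add: extend_curve_def)
qed

lemma Gam_rate:
  assumes yT: "((\<lambda>t. y (real_of_ereal t)) \<longlongrightarrow> yT) (at_left T)"
    and t: "0 \<le> t" "t \<le> t_star f T y" and r: "ereal r < theta_infty \<theta>"
  defines "d \<equiv> dist (extend_curve T y yT t) yT"
  shows "ereal d < theta_infty \<theta>" "Gam \<theta> d \<le> Gam \<theta> r - t"
proof -
  define A where "A = real_of_ereal (f (extend_curve T y yT t))"
  have tT: "t \<le> T" using t by (simp add: t_star_def)
  have A0: "0 \<le> A" "0 \<le> real_of_ereal (f yT)" using f_nonneg by (auto simp: A_def real_of_ereal_pos)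
  have eT: "extend_curve T y yT T = yT" by (simp add: extend_curve_def)
  have e0: "extend_curve T y yT 0 = y 0" using T_pos by (simp add: extend_curve_def)
  have dA: "d \<le> \<theta> A"
    using dissipation_extended[OF yT t(1) tT order_refl] theta_nonneg[OF A0(2)]
    unfolding eT by (simp add: d_def A_def dist_commute)
  have "\<theta> A \<le> \<theta> (h 0)"
    using dissipation_extended[OF yT order_refl t(1) tT] unfolding e0
    by (simp add: A_def h_def) (smt (verit) zero_le_dist)
  then have "d \<le> r" using dA h_0(3) by simp
  then show "ereal d < theta_infty \<theta>" using r by (meson ereal_less_eq(3) le_less_trans)
  have "0 \<le> d" by (simp add: d_def)
  then obtain u where u: "0 \<le> u" "u \<le> A" "\<theta> u = d" using parameter_function_IVT[OF param _ dA A0(1)] by blast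
  obtain w where w: "0 \<le> w" "r < \<theta> w" using less_theta_infty[OF param r] by blast
  then obtain R where R: "0 \<le> R" "\<theta> R = r"
    using parameter_function_IVT[OF param, of r w] r_pos by (metis less_le)
  have "h 0 \<le> R"
  proof (rule ccontr)
    assume "\<not> h 0 \<le> R"
    then have "\<theta> R < \<theta> (h 0)" using parameter_function_strict_mono[OF param R(1)] by simp
    then show False using h_0(3) R by simp
  qed
  have "Gam \<theta> d = eta \<theta> u" using Gam_theta[OF param u(1)] u(3) by simp
  also have "\<dots> \<le> eta \<theta> A" by (rule eta_mono[OF u(2)])
  also have "\<dots> \<le> eta \<theta> (h 0) - t" unfolding A_def by (rule eta_rate[OF yT t])
  also have "\<dots> \<le> eta \<theta> R - t" by (intro ereal_minus_mono eta_mono \<open>h 0 \<le> R\<close> order_refl)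
  also have "eta \<theta> R = Gam \<theta> r" using Gam_theta[OF param R(1)] R(2) by simp
  finally show "Gam \<theta> d \<le> Gam \<theta> r - t" .
qed

lemma endpoint_zero:
  assumes yT: "((\<lambda>t. y (real_of_ereal t)) \<longlongrightarrow> yT) (at_left T)" and T: "T = \<infinity>"
  shows "f yT = 0"
proof (rule ccontr)
  assume "f yT \<noteq> 0"
  then have fT: "0 < f yT" using f_nonneg[of yT] by simp
  have pos: "0 < f (y t)" if "t \<in> times_below T" for t
    using fT f_endpoint_le[OF yT that] by simp
  then have empty: "{t \<in> times_below T. f (y t) = 0} = {}" by force
  have ts: "t_star f T y = \<infinity>" unfolding t_star_def empty using T by (simp add: top_ereal_def)
  have "f yT \<noteq> \<infinity>" using f_endpoint_le[OF yT zero_in] f_eq_h[OF zero_in] by auto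
  then have "0 < real_of_ereal (f yT)" using fT by (cases "f yT") auto
  moreover have "0 < h 0" using pos[OF zero_in] f_eq_h[OF zero_in] by (simp add: zero_ereal_def)
  moreover obtain G where "\<And>u. 0 < u \<Longrightarrow> (G has_real_derivative (deriv \<theta> u)\<^sup>2) (at u)"
    and "\<And>u. 0 < u \<Longrightarrow> eta \<theta> u = ereal (G u)" using eta_antiderivative[OF param] by blast
  moreover have "eta \<theta> (real_of_ereal (f yT)) \<le> eta \<theta> (h 0) - \<infinity>"
    using eta_rate[OF yT, of \<infinity>] ts T by (simp add: extend_curve_def)
  ultimately show False by simp
qed

end

theorem theorem1p4:
  fixes f :: "'a::complete_space \<Rightarrow> ereal"
    and x0 :: 'a and r :: real and \<theta> :: "real \<Rightarrow> real"
    and T :: ereal and y :: "real \<Rightarrow> 'a"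
  assumes "\<And>x. 0 \<le> f x"
    and "proper_fun f"
    and "lower_semicont f"
    and "x0 \<in> dom_of f"
    and "0 < r"
    and "parameter_function \<theta>"
    and "condition_A f \<theta> x0 r"
    and "0 < T"
    and "max_slope_curve f (times_below T) y"
    and "starts_at (times_below T) y x0"
  shows
    "(\<forall>t\<in>times_below T. y t \<in> closure (ball x0 r)) \<and>
     (\<forall>t\<in>times_below T. f (y t) > 0 \<longrightarrow> y t \<in> ball x0 r) \<and>
     (\<exists>yT. ((\<lambda>t. y (real_of_ereal t)) \<longlongrightarrow> yT) (at_left T) \<and>
        yT \<in> closure (ball x0 r) \<and>
        f yT < \<infinity> \<and>
        (\<forall>s t. 0 \<le> s \<and> s \<le> t \<and> t \<le> T \<longrightarrow>
           \<theta> (real_of_ereal (f (extend_curve T y yT s)))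
             - \<theta> (real_of_ereal (f (extend_curve T y yT t)))
           \<ge> dist (extend_curve T y yT t) (extend_curve T y yT s)) \<and>
        (f yT > 0 \<longrightarrow> yT \<in> ball x0 r) \<and>
        (\<forall>t. 0 \<le> t \<and> t \<le> t_star f T y \<longrightarrow>
           (ereal r < theta_infty \<theta> \<longrightarrow>
              ereal (dist (extend_curve T y yT t) yT) < theta_infty \<theta> \<and>
              Gam \<theta> (dist (extend_curve T y yT t) yT) \<le> Gam \<theta> r - t) \<and>
           eta \<theta> (real_of_ereal (f (extend_curve T y yT t)))
             \<le> eta \<theta> (real_of_ereal (f x0)) - t) \<and>
        (T = \<infinity> \<longrightarrow> f yT = 0))"
proof -
  interpret condition_A_curve f x0 r \<theta> T y
    by unfold_locales (use assms in auto)
  obtain yT where yT: "((\<lambda>t. y (real_of_ereal t)) \<longlongrightarrow> yT) (at_left T)"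
    using endpoint_exists by blast
  have ball: "y t \<in> ball x0 r" if "t \<in> times_below T" "f (y t) > 0" for t
    using confined[of t t] that f_eq_h[of t] by (auto simp: times_below_def zero_ereal_def)
  have closure: "yT \<in> closure (ball x0 r)"
  proof (rule Lim_in_closed_set[OF closed_closure _ at_left_T_neq_bot yT])
    show "\<forall>\<^sub>F u in at_left T. y (real_of_ereal u) \<in> closure (ball x0 r)"
      using eventually_below_T[OF zero_in] by eventually_elim (use in_closure_ball in auto)
  qed
  have finite: "f yT < \<infinity>" using f_endpoint_le[OF yT zero_in] f_eq_h[OF zero_in] by (auto simp: less_top[symmetric])
  have ball_T: "yT \<in> ball x0 r" if "f yT > 0"
  proof -
    have "0 < real_of_ereal (f yT)" using that finite by (cases "f yT") auto
    then have "dist yT (y 0) < r"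
      using dissipation_endpoint[OF yT zero_in] theta_pos h_0(3) by fastforce
    then show ?thesis by (simp add: y_0 dist_commute)
  qed
  show ?thesis
    using in_closure_ball ball closure finite ball_T dissipation_extended[OF yT]
      Gam_rate[OF yT] eta_rate[OF yT] endpoint_zero[OF yT] yT
    unfolding h_0(1) by blast
qed

end
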